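(* Let $\theta=\frac12$. In the setting described in the context, there exists $\beta>0$ such that $$\sup_{y\in Y_n,\ \|y\|_Y=1}b(x,y)\ge\beta\|x\|_Z\quad\text{for all }x\in X_n,$$ with the following dependencies. (Case $\|\Phi\|<1$.) $\beta$ may be chosen depending only on $T$, $\alpha$, $M$ and $\|\Phi\|$. (Case $\|\Phi\|=1$.) Assume that $k\mu_n\le C$ for some given $C>0$. Then $\beta$ may be chosen depending only on $\alpha$, $M$, $T$ and $C$.
   Context: All vector spaces are real. Let $T>0$ and let $U,H$ be Hilbert spaces with $U$ continuously and densely embedded in $H$; $C_H>0$ satisfies $\|v\|_H\le C_H\|v\|_U$ for all $v\in U$. $H$ is identified with a subspace of $U'$ by $\langle y,u\rangle_{U',U}=\langle y,u\rangle_H$. Put $V=L^2(0,T;U)$, $V'=L^2(0,T;U')$, $\mathbb{H}=L^2(0,T;H)$. Let $a:[0,T]\times U\times U\to\mathbb{R}$ be such that $a(t,\cdot,\cdot)$ is bilinear for all $t$, $a(\cdot,v,w)$ is measurable for all $v,w\in U$, $|a(t,v,w)|\le M\|v\|_U\|w\|_U$ for a.e. $t$ and all $v,w\in U$, with $M\ge1$, and $a(t,v,v)\ge\alpha\|v\|_U^2$ for all $t\in[0,T]$, $v\in U$, with $\alpha>0$. Define $\mathcal{A}\in\mathcal{L}(V,V')$ by $\langle\mathcal{A}v,w\rangle_{V',V}=\int_0^Ta(t,v(t),w(t))\,dt$. Let $\Phi:H\to H$ be linear with $\|\Phi\|\le1$. $G$ is the Banach space of bounded functions $w:[0,T]\to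 H$ (defined everywhere) which define an element of $V$, with $\|w\|_G^2=\sup_{t\in[0,T]}\|w(t)\|_H^2+\|w\|_V^2$. Put $Z=V'\times G$ with $\|(z_1,z_2)\|_Z^2=\|z_1\|_{V'}^2+\|z_2\|_G^2$, $Y=V\times H$ with $\|(y_1,y_2)\|_Y^2=\|y_1\|_V^2+\|y_2\|_H^2$, and $b:Z\times Y\to\mathbb{R}$, $$b((z_1,z_2),(y_1,y_2))=\langle z_1+\mathcal{A}z_2,y_1\rangle_{V',V}+\langle z_2(0)-\Phi z_2(T),y_2\rangle_H .$$ Let $U_n\neq\{0\}$ be a finite dimensional subspace of $U$, $N\ge1$ an integer, $k=T/N$, and $\mu_n=\max\{\|u\|_U/\|u\|_H:u\in U_n\setminus\{0\}\}$. $W_n\subset G$ is the space of functions $w:[0,T]\to U_n$ for which there are $w^{(0)},\dots,w^{(N)}\in U_n$ with $w(mk)=w^{(m)}$ for $m=0,\dots,N$ and $w(t)=\theta w^{(m+1)}+(1-\theta)w^{(m)}$ (here $\theta=\frac12$) for $t\in(mk,(m+1)k)$, $m=0,\dots,N-1$. $V_n\subset V$ is the space of functions $(0,T)\to U_n$ constant on each $(mk,(m+1)k)$, $m=0,\dots,N-1$, and $P^V_n$ is the orthogonal projection of $V$ onto $V_n$. For $w\in W_n$ put $\partial w(t)=\frac{w^{(m+1)}-w^{(m)}}{k}$ for $t\in(mk,(m+1)k)$, and define $\widehat{\partial}w\in V'$ by $\langle\widehat{\partial}w,v\rangle_{V',V}=\langle\partial w,P^V_nv\rangle_{\mathbb{H}}$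 for all $v\in V$. Finally $X_n=\{(\widehat{\partial}w,w):w\in W_n\}\subset Z$ and $Y_n=V_n\times U_n\subset Y$.
   Formalization: For ‖Φ‖=1, β may also depend on the embedding constant C_H; independence of C_H fails (U=H=ℝ, ‖u‖_U=ε|u|, a=ε²vw, Φ=id, N=1, w=1). In both cases β is stated for each fixed pair U,H; uniformity over all pairs follows by ℓ²-direct sums. *)

theory Defs
  imports "HOL-Analysis.Analysis"
begin

section \<open>Bochner spaces of square integrable functions on an interval\<close>

text \<open>
  Elements of a space of type L2 on (0,T) are represented by functions on the reals of which only
  the restriction to [0,T], up to null sets, matters. The Bochner integration theory of the library
  is restricted to second countable value spaces. As the Hilbert spaces below need not be separable,
  strong (Bochner) measurability is spelled out: almost everywhere limits of simple functions.
\<close>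

abbreviation leb :: "real \<Rightarrow> real measure" where
  "leb T \<equiv> lebesgue_on {0..T}"

definition strongly_measurable :: "'a measure \<Rightarrow> ('a \<Rightarrow> 'b::real_normed_vector) \<Rightarrow> bool" where
  "strongly_measurable \<M> f \<longleftrightarrow>
     (\<exists>s. (\<forall>i::nat. simple_function \<M> (s i)) \<and> (AE x in \<M>. (\<lambda>i. s i x) \<longlonglongrightarrow> f x))"

definition L2 :: "real \<Rightarrow> (real \<Rightarrow> 'b::real_normed_vector) set" where
  "L2 T = {f. strongly_measurable (leb T) f \<and> integrable (leb T) (\<lambda>t. (norm (f t))\<^sup>2)}"

definition L2_norm :: "real \<Rightarrow> (real \<Rightarrow> 'b::real_normed_vector) \<Rightarrow> real" where
  "L2_norm T f = sqrt (\<integral>t. (norm (f t))\<^sup>2 \<partial>leb T)"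

definition L2_inner :: "real \<Rightarrow> (real \<Rightarrow> 'b::real_inner) \<Rightarrow> (real \<Rightarrow> 'b) \<Rightarrow> real" where
  "L2_inner T f g = (\<integral>t. inner (f t) (g t) \<partial>leb T)"

text \<open>
  \<open>L2 T :: (real \<Rightarrow> 'u) set\<close> is V and \<open>L2 T :: (real \<Rightarrow> ('u \<Rightarrow>\<^sub>L real)) set\<close> is V', where
  \<open>'u \<Rightarrow>\<^sub>L real\<close> with the operator norm is U'. The pairing of V' and V is the following one.
\<close>

definition dual_pairing :: "real \<Rightarrow> (real \<Rightarrow> ('u::real_normed_vector \<Rightarrow>\<^sub>L real)) \<Rightarrow> (real \<Rightarrow> 'u) \<Rightarrow> real" where
  "dual_pairing T z v = (\<integral>t. blinfun_apply (z t) (v t) \<partial>leb T)"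


section \<open>The continuous setting\<close>

text \<open>The inclusion of U into H is an explicit injective map \<open>\<iota>\<close>.\<close>

definition dense_embedding ::
  "('u::real_normed_vector \<Rightarrow> 'h::real_normed_vector) \<Rightarrow> real \<Rightarrow> bool" where
  "dense_embedding \<iota> C\<^sub>H \<longleftrightarrow>
     linear \<iota> \<and> inj \<iota> \<and> closure (range \<iota>) = UNIV \<and> C\<^sub>H > 0 \<and> (\<forall>v. norm (\<iota> v) \<le> C\<^sub>H * norm v)"

definition admissible_form ::
  "real \<Rightarrow> real \<Rightarrow> real \<Rightarrow> (real \<Rightarrow> 'u::real_normed_vector \<Rightarrow> 'u \<Rightarrow> real) \<Rightarrow> bool" where
  "admissible_form T M \<alpha> a \<longleftrightarrow>
     (\<forall>t\<in>{0..T}. bilinear (a t)) \<and>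
     (\<forall>v w. (\<lambda>t. a t v w) \<in> borel_measurable (leb T)) \<and>
     (AE t in leb T. \<forall>v w. \<bar>a t v w\<bar> \<le> M * norm v * norm w) \<and>
     (\<forall>t\<in>{0..T}. \<forall>v. a t v v \<ge> \<alpha> * (norm v)\<^sup>2)"

text \<open>\<open>A_pairing T a v w\<close> is the pairing of \<open>A v\<close> in V' with \<open>w\<close> in V.\<close>

definition A_pairing ::
  "real \<Rightarrow> (real \<Rightarrow> 'u \<Rightarrow> 'u \<Rightarrow> real) \<Rightarrow> (real \<Rightarrow> 'u) \<Rightarrow> (real \<Rightarrow> 'u) \<Rightarrow> real" where
  "A_pairing T a v w = (\<integral>t. a t (v t) (w t) \<partial>leb T)"

text \<open>
  An H-valued function that takes values in U almost everywhere, read as a U-valued one. As \<open>\<iota>\<close> is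
  injective, this is \<open>v\<close> for the function \<open>\<iota> \<circ> v\<close>.
\<close>

definition to_V :: "('u \<Rightarrow> 'h) \<Rightarrow> (real \<Rightarrow> 'h) \<Rightarrow> real \<Rightarrow> 'u" where
  "to_V \<iota> w = (\<lambda>t. inv \<iota> (w t))"

definition G_space :: "('u::real_normed_vector \<Rightarrow> 'h::real_normed_vector) \<Rightarrow> real \<Rightarrow> (real \<Rightarrow> 'h) set" where
  "G_space \<iota> T = {w. bounded (w ` {0..T}) \<and> (AE t in leb T. w t \<in> range \<iota>) \<and> to_V \<iota> w \<in> L2 T}"

definition G_norm :: "('u::real_normed_vector \<Rightarrow> 'h::real_normed_vector) \<Rightarrow> real \<Rightarrow> (real \<Rightarrow> 'h) \<Rightarrow> real" where
  "G_norm \<iota> T w = sqrt ((SUP t\<in>{0..T}. (norm (w t))\<^sup>2) + (L2_norm T (to_V \<iota> w))\<^sup>2)"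

definition Z_norm ::
  "('u::real_normed_vector \<Rightarrow> 'h::real_normed_vector) \<Rightarrow> real \<Rightarrow>
     (real \<Rightarrow> ('u \<Rightarrow>\<^sub>L real)) \<times> (real \<Rightarrow> 'h) \<Rightarrow> real" where
  "Z_norm \<iota> T = (\<lambda>(z1, z2). sqrt ((L2_norm T z1)\<^sup>2 + (G_norm \<iota> T z2)\<^sup>2))"

definition Y_norm ::
  "real \<Rightarrow> (real \<Rightarrow> 'u::real_normed_vector) \<times> 'h::real_normed_vector \<Rightarrow> real" where
  "Y_norm T = (\<lambda>(y1, y2). sqrt ((L2_norm T y1)\<^sup>2 + (norm y2)\<^sup>2))"

definition b_form ::
  "('u::real_normed_vector \<Rightarrow> 'h::real_inner) \<Rightarrow> real \<Rightarrow> (real \<Rightarrow> 'u \<Rightarrow> 'u \<Rightarrow> real) \<Rightarrow> ('h \<Rightarrow>\<^sub>L 'h) \<Rightarrow>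
     (real \<Rightarrow> ('u \<Rightarrow>\<^sub>L real)) \<times> (real \<Rightarrow> 'h) \<Rightarrow> (real \<Rightarrow> 'u) \<times> 'h \<Rightarrow> real" where
  "b_form \<iota> T a \<Phi> = (\<lambda>(z1, z2) (y1, y2).
     (dual_pairing T z1 y1 + A_pairing T a (to_V \<iota> z2) y1)
       + inner (z2 0 - blinfun_apply \<Phi> (z2 T)) y2)"


section \<open>The discrete setting\<close>

definition admissible_subspace :: "'u::real_vector set \<Rightarrow> bool" where
  "admissible_subspace U\<^sub>n \<longleftrightarrow> subspace U\<^sub>n \<and> (\<exists>B. finite B \<and> U\<^sub>n = span B) \<and> U\<^sub>n \<noteq> {0}"

text \<open>The maximum is attained, so it is the supremum; \<open>Max\<close> is meaningful for finite sets only.\<close>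

definition mu :: "('u::real_normed_vector \<Rightarrow> 'h::real_normed_vector) \<Rightarrow> 'u set \<Rightarrow> real" where
  "mu \<iota> U\<^sub>n = (SUP u\<in>U\<^sub>n - {0}. norm u / norm (\<iota> u))"

definition step :: "real \<Rightarrow> nat \<Rightarrow> real" where
  "step T N = T / real N"

definition node :: "real \<Rightarrow> nat \<Rightarrow> nat \<Rightarrow> real" where
  "node T N m = real m * step T N"

definition W_space ::
  "real \<Rightarrow> ('u::real_normed_vector \<Rightarrow> 'h::real_normed_vector) \<Rightarrow> real \<Rightarrow> 'u set \<Rightarrow> nat \<Rightarrow> (real \<Rightarrow> 'h) set" where
  "W_space \<theta> \<iota> T U\<^sub>n N = {w \<in> G_space \<iota> T. \<exists>c::nat \<Rightarrow> 'u.
     (\<forall>m\<le>N. c m \<in> U\<^sub>n \<and> w (node T N m) = \<iota> (c m)) \<and>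
     (\<forall>m<N. \<forall>t\<in>{node T N m<..<node T N (Suc m)}.
        w t = \<iota> (\<theta> *\<^sub>R c (Suc m) + (1 - \<theta>) *\<^sub>R c m))}"

definition V_space :: "real \<Rightarrow> 'u::real_normed_vector set \<Rightarrow> nat \<Rightarrow> (real \<Rightarrow> 'u) set" where
  "V_space T U\<^sub>n N = {v \<in> L2 T. \<exists>c::nat \<Rightarrow> 'u.
     \<forall>m<N. c m \<in> U\<^sub>n \<and> (\<forall>t\<in>{node T N m<..<node T N (Suc m)}. v t = c m)}"

text \<open>The orthogonal projection of V onto \<open>V_space\<close>, which is unique up to null sets.\<close>

definition proj_V :: "real \<Rightarrow> 'u::real_inner set \<Rightarrow> nat \<Rightarrow> (real \<Rightarrow> 'u) \<Rightarrow> real \<Rightarrow> 'u" where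
  "proj_V T U\<^sub>n N v = (SOME p. p \<in> V_space T U\<^sub>n N \<and>
     (\<forall>y\<in>V_space T U\<^sub>n N. L2_inner T (\<lambda>t. v t - p t) y = 0))"

definition diff_quot :: "real \<Rightarrow> nat \<Rightarrow> (real \<Rightarrow> 'h::real_normed_vector) \<Rightarrow> real \<Rightarrow> 'h" where
  "diff_quot T N w t = (\<Sum>m<N. indicat_real {node T N m<..<node T N (Suc m)} t *\<^sub>R
     ((w (node T N (Suc m)) - w (node T N m)) /\<^sub>R step T N))"

text \<open>
  The first component of an element of \<open>X_space\<close> is the element of V' representing the functional
  on V that maps \<open>v\<close> to the H-valued L2 inner product of \<open>diff_quot T N w\<close> and the projection
  of \<open>v\<close>. It is unique up to null sets.
\<close>

definition X_space ::
  "real \<Rightarrow> ('u::real_inner \<Rightarrow> 'h::real_inner) \<Rightarrow> real \<Rightarrow> 'u set \<Rightarrow> nat \<Rightarrow>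
     ((real \<Rightarrow> ('u \<Rightarrow>\<^sub>L real)) \<times> (real \<Rightarrow> 'h)) set" where
  "X_space \<theta> \<iota> T U\<^sub>n N = {(z, w). w \<in> W_space \<theta> \<iota> T U\<^sub>n N \<and> z \<in> L2 T \<and>
     (\<forall>v\<in>L2 T. dual_pairing T z v = L2_inner T (diff_quot T N w) (\<lambda>t. \<iota> (proj_V T U\<^sub>n N v t)))}"

definition Y_space ::
  "('u::real_normed_vector \<Rightarrow> 'h) \<Rightarrow> real \<Rightarrow> 'u set \<Rightarrow> nat \<Rightarrow> ((real \<Rightarrow> 'u) \<times> 'h) set" where
  "Y_space \<iota> T U\<^sub>n N = V_space T U\<^sub>n N \<times> \<iota> ` U\<^sub>n"

definition inf_sup_bound ::
  "real \<Rightarrow> ('u::real_inner \<Rightarrow> 'h::real_inner) \<Rightarrow> real \<Rightarrow> (real \<Rightarrow> 'u \<Rightarrow> 'u \<Rightarrow> real) \<Rightarrow> ('h \<Rightarrow>\<^sub>L 'h) \<Rightarrow>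
     'u set \<Rightarrow> nat \<Rightarrow> real \<Rightarrow> bool" where
  "inf_sup_bound \<theta> \<iota> T a \<Phi> U\<^sub>n N \<beta> \<longleftrightarrow>
     (\<forall>x\<in>X_space \<theta> \<iota> T U\<^sub>n N.
        (SUP y\<in>{y \<in> Y_space \<iota> T U\<^sub>n N. Y_norm T y = 1}. b_form \<iota> T a \<Phi> x y) \<ge> \<beta> * Z_norm \<iota> T x)"

end

theory Submission
  imports Defs
begin

text \<open>
  Let \<open>S\<close> be the supremum on the left, \<open>h m\<close> the nodal values of \<open>w\<close> in H, and \<open>W\<close> the
  squared V-norm of \<open>w\<close>. Testing with the midpoint values of \<open>w\<close> on the intervals from
  \<open>i\<close> to \<open>j\<close> makes the discrete time derivative telescope, so that \<open>|h j|^2\<close> plus \<open>\<alpha>\<close> times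
  the part of \<open>W\<close> on these intervals is at most \<open>|h i|^2 + S^2 / \<alpha>\<close>. Testing with \<open>(0, h 0)\<close> gives
  \<open>|h 0| \<le> |\<Phi>| |h N| + S\<close>, and the equation itself bounds the V'-norm of the discrete derivative
  by \<open>E = S + M sqrt W\<close>. It remains to control \<open>|h N|\<close> and \<open>W\<close> by \<open>S\<close>.

  If \<open>|\<Phi>| < 1\<close>, insert the second estimate into the first one. If \<open>|\<Phi>| = 1\<close>, these
  two only give \<open>W\<close> of the order \<open>S^2 + S |h N|\<close>. Testing with the increments of \<open>w\<close> and the
  inverse inequality show that \<open>k\<close> times the sum of their squared H-norms is at most \<open>C^2 E^2\<close>. Each nodal
  value is a midpoint value plus half an increment, so averaging the first estimate with \<open>j = N\<close>
  over \<open>i\<close> yields \<open>|h N|^2 \<le> K (W + S^2)\<close>, which closes the argument.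
\<close>

section \<open>Hilbert spaces and square integrable functions\<close>

text \<open>Lebesgue measure is complete, so a change on a null set preserves measurability;
  extension by zero moves the question from \<open>S\<close> to the whole space.\<close>

lemma borel_measurable_lebesgue_on_AE:
  fixes f g :: "'a::euclidean_space \<Rightarrow> 'b::euclidean_space"
  assumes S: "S \<in> sets lebesgue" and f: "f \<in> borel_measurable (lebesgue_on S)"
    and fg: "AE x in lebesgue_on S. f x = g x"
  shows "g \<in> borel_measurable (lebesgue_on S)"
proof -
  have "AE x in lebesgue. x \<in> S \<longrightarrow> f x = g x"
    using fg S by (subst (asm) AE_restrict_space_iff) auto
  then have "AE x in lebesgue. (if x \<in> S then f x else 0) = (if x \<in> S then g x else 0)"
    by eventually_elim auto
  with f show ?thesis
    unfolding borel_measurable_if[OF S, symmetric] by (rule borel_measurable_AE)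
qed

lemma strongly_measurable_inner:
  fixes v :: "real \<Rightarrow> 'b::real_inner"
  assumes "strongly_measurable (leb T) v"
  shows "(\<lambda>t. v t \<bullet> u) \<in> borel_measurable (leb T)"
proof -
  obtain s where s: "\<And>i::nat. simple_function (leb T) (s i)"
    and lim: "AE t in leb T. (\<lambda>i. s i t) \<longlonglongrightarrow> v t"
    using assms unfolding strongly_measurable_def by blast
  have "(\<lambda>t. s i t \<bullet> u) \<in> borel_measurable (leb T)" for i
    by (intro borel_measurable_simple_function simple_function_compose1[OF s])
  \<comment> \<open>\<open>lim\<close> is total, so this function is measurable although the
    approximation converges only almost everywhere.\<close>
  then have "(\<lambda>t. lim (\<lambda>i. s i t \<bullet> u)) \<in> borel_measurable (leb T)"
    by measurable
  moreover have "AE t in leb T. lim (\<lambda>i. s i t \<bullet> u) = v t \<bullet> u"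
    using lim by eventually_elim (intro limI tendsto_inner tendsto_const)
  ultimately show ?thesis
    by (rule borel_measurable_lebesgue_on_AE[rotated]) simp
qed

lemma L2_integrable_inner:
  fixes v :: "real \<Rightarrow> 'b::real_inner"
  assumes "v \<in> L2 T"
  shows "integrable (leb T) (\<lambda>t. v t \<bullet> u)"
proof (rule Bochner_Integration.integrable_bound)
  show "integrable (leb T) (\<lambda>t. (norm (v t))\<^sup>2 + (norm u)\<^sup>2)"
    using assms by (auto simp: L2_def)
  show "(\<lambda>t. v t \<bullet> u) \<in> borel_measurable (leb T)"
    using assms by (auto simp: L2_def intro: strongly_measurable_inner)
  have "\<bar>v t \<bullet> u\<bar> \<le> (norm (v t))\<^sup>2 + (norm u)\<^sup>2" for t
  proof -
    have "\<bar>v t \<bullet> u\<bar> \<le> norm (v t) * norm u" by (rule Cauchy_Schwarz_ineq2)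
    also have "\<dots> \<le> (norm (v t))\<^sup>2 + (norm u)\<^sup>2"
      using sum_squares_bound[of "norm (v t)" "norm u"] mult_nonneg_nonneg[of "norm (v t)" "norm u"]
      by (simp del: mult_nonneg_nonneg)
    finally show ?thesis .
  qed
  then show "AE t in leb T. norm (v t \<bullet> u) \<le> norm ((norm (v t))\<^sup>2 + (norm u)\<^sup>2)"
    by auto
qed

text \<open>The functional is represented by the minimiser of the energy \<open>u \<bullet> u / 2 - f u\<close>.\<close>

lemma riesz_representation:
  fixes f :: "'u::{real_inner,complete_space} \<Rightarrow>\<^sub>L real"
  shows "\<exists>u. \<forall>v. blinfun_apply f v = u \<bullet> v"
proof -
  define J where "J u = u \<bullet> u / 2 - f u" for u
  define m where "m = Inf (range J)"
  have "- (norm f)\<^sup>2 / 2 \<le> J u" for u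
  proof -
    have "f u \<le> norm f * norm u"
      using norm_blinfun[of f u] by simp
    moreover have "2 * (norm f * norm u) \<le> (norm f)\<^sup>2 + u \<bullet> u"
      using sum_squares_bound[of "norm f" "norm u"] by (simp add: power2_norm_eq_inner)
    ultimately show ?thesis
      by (simp add: J_def field_simps)
  qed
  then have bdd: "bdd_below (range J)"
    by (meson bdd_belowI2)
  have m_le: "m \<le> J u" for u
    unfolding m_def by (rule cINF_lower[OF bdd]) simp
  have "\<exists>u. J u < m + 1 / real (Suc n)" for n
  proof (rule ccontr)
    assume "\<not> ?thesis"
    then have "m + 1 / real (Suc n) \<le> m"
      unfolding m_def by (intro cINF_greatest) (auto simp: not_less)
    then show False by simp
  qed
  then obtain u where u: "\<And>n. J (u n) < m + 1 / real (Suc n)"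
    by metis
  \<comment> \<open>Parallelogram identity: the linear parts of \<open>J\<close> cancel. As the
    midpoint cannot have energy below \<open>m\<close>, two near-minimisers must be close to each
    other.\<close>
  have par: "(norm (x - y))\<^sup>2 = 4 * (J x + J y - 2 * J ((1/2) *\<^sub>R (x + y)))" for x y
    by (simp add: J_def power2_norm_eq_inner inner_diff inner_add blinfun.bilinear_simps inner_commute
        algebra_simps)
  have close: "(norm (u i - u j))\<^sup>2 < 8 / real (Suc n)" if "n \<le> i" "n \<le> j" for i j n
  proof -
    have "1 / real (Suc i) \<le> 1 / real (Suc n)" "1 / real (Suc j) \<le> 1 / real (Suc n)"
      using that by (auto intro!: divide_left_mono)
    then show ?thesis
      using par[of "u i" "u j"] u[of i] u[of j] m_le[of "(1/2) *\<^sub>R (u i + u j)"] by simp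
  qed
  have "Cauchy u"
  proof (rule CauchyI)
    fix e :: real assume "e > 0"
    then obtain n where n: "8 / e\<^sup>2 < real n"
      using reals_Archimedean2 by blast
    show "\<exists>n. \<forall>i\<ge>n. \<forall>j\<ge>n. norm (u i - u j) < e"
    proof (intro exI allI impI)
      fix i j assume "n \<le> i" "n \<le> j"
      have "8 / real (Suc n) < e\<^sup>2"
        using n \<open>e > 0\<close> by (simp add: field_simps) (smt (verit) zero_less_power)
      then have "(norm (u i - u j))\<^sup>2 < e\<^sup>2"
        using close[OF \<open>n \<le> i\<close> \<open>n \<le> j\<close>] by linarith
      then show "norm (u i - u j) < e"
        using \<open>e > 0\<close> by (meson less_imp_le power2_less_imp_less)
    qed
  qed
  then obtain l where l: "u \<longlonglongrightarrow> l"
    using Cauchy_convergent convergent_def by blast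
  have "(\<lambda>n. J (u n)) \<longlonglongrightarrow> J l"
    unfolding J_def by (intro tendsto_intros l) auto
  moreover have "(\<lambda>n. m + 1 / real (Suc n)) \<longlonglongrightarrow> m + 0"
    by (intro tendsto_intros LIMSEQ_Suc[OF lim_1_over_n])
  ultimately have "J l \<le> m + 0"
    by (rule LIMSEQ_le) (use u less_imp_le in blast)
  then have J_min: "J l \<le> J x" for x
    using m_le[of x] by simp
  have "f v = l \<bullet> v" for v
  proof (cases "v = 0")
    case False
    define d where "d = f v - l \<bullet> v"
    \<comment> \<open>The step length that minimises the quadratic
      \<open>J (l + s *\<^sub>R v)\<close> in \<open>s\<close>; it lowers the energy by half of
      \<open>d\<^sup>2 / (v \<bullet> v)\<close>.\<close>
    define s where "s = d / (v \<bullet> v)"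
    have v: "v \<bullet> v > 0" using False by simp
    have "J (l + s *\<^sub>R v) = J l - s * d + s * s * (v \<bullet> v) / 2"
      by (simp add: J_def d_def inner_add inner_commute blinfun.bilinear_simps algebra_simps add_divide_distrib)
    also have "\<dots> = J l - (1/2) * (d\<^sup>2 / (v \<bullet> v))"
      using v by (simp add: s_def power2_eq_square field_simps)
    finally have "d\<^sup>2 / (v \<bullet> v) \<le> 0"
      using J_min[of "l + s *\<^sub>R v"] by linarith
    then have "d = 0" using v by (simp add: divide_le_0_iff)
    then show ?thesis by (simp add: d_def)
  qed (simp add: blinfun.bilinear_simps)
  then show ?thesis by blast
qed

text \<open>Turns elements of V' into elements of V, to which \<open>proj_V\<close> applies. The
  Riesz map \<open>R\<close> is 1-Lipschitz, so it carries simple functions converging to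
  \<open>z\<close> to simple functions converging to the representative.\<close>

lemma L2_riesz:
  fixes z :: "real \<Rightarrow> ('u::{real_inner,complete_space} \<Rightarrow>\<^sub>L real)"
  assumes "z \<in> L2 T"
  obtains r where "r \<in> L2 T" "\<And>t. norm (r t) = norm (z t)" "\<And>t v. blinfun_apply (z t) v = r t \<bullet> v"
proof -
  obtain R :: "('u \<Rightarrow>\<^sub>L real) \<Rightarrow> 'u" where R: "\<And>f v. blinfun_apply f v = R f \<bullet> v"
    using riesz_representation by metis
  have le: "norm (R f - R g) \<le> norm (f - g)" for f g
  proof -
    have "(norm (R f - R g))\<^sup>2 = (f - g) (R f - R g)"
      by (simp only: blinfun.diff_left, simp only: R) (simp add: power2_norm_eq_inner inner_diff)
    also have "\<dots> \<le> norm (f - g) * norm (R f - R g)"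
      using norm_blinfun[of "f - g" "R f - R g"] by simp
    finally show ?thesis
      by (cases "R f = R g") (auto simp: power2_eq_square)
  qed
  have "R 0 \<bullet> R 0 = 0" using R[of 0 "R 0"] by simp
  then have R0: "R 0 = 0" by simp
  have norm_R: "norm (R f) = norm f" for f
  proof (rule antisym)
    show "norm (R f) \<le> norm f" using le[of f 0] R0 by simp
    show "norm f \<le> norm (R f)"
      by (rule norm_blinfun_bound) (auto simp: R intro: Cauchy_Schwarz_ineq2)
  qed
  obtain s where s: "\<And>i::nat. simple_function (leb T) (s i)"
    and lim: "AE t in leb T. (\<lambda>i. s i t) \<longlonglongrightarrow> z t"
    using assms unfolding L2_def strongly_measurable_def by blast
  have R_lim: "(\<lambda>i. R (f i)) \<longlonglongrightarrow> R g" if "f \<longlonglongrightarrow> g" for f :: "nat \<Rightarrow> _" and g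
    by (rule metric_tendsto_imp_tendsto[OF that]) (use le in \<open>auto simp: dist_norm\<close>)
  have "strongly_measurable (leb T) (\<lambda>t. R (z t))"
    unfolding strongly_measurable_def
  proof (intro exI conjI allI)
    show "simple_function (leb T) (\<lambda>t. R (s i t))" for i
      by (rule simple_function_compose1[OF s])
    show "AE t in leb T. (\<lambda>i. R (s i t)) \<longlonglongrightarrow> R (z t)"
      using lim by eventually_elim (rule R_lim)
  qed
  then have "(\<lambda>t. R (z t)) \<in> L2 T"
    using assms by (simp add: L2_def norm_R)
  then show thesis
    by (rule that) (simp_all add: norm_R R)
qed

text \<open>Zero vectors in the orthogonal set \<open>B\<close> contribute \<open>0 / 0 = 0\<close>.\<close>

lemma orthogonal_expansion:
  fixes B :: "'a::real_inner set"
  assumes "finite B" "pairwise orthogonal B" "x \<in> span B"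
  shows "(\<Sum>e\<in>B. ((x \<bullet> e) / (e \<bullet> e)) *\<^sub>R e) = x"
  using assms(3)
proof (induction rule: span_induct_alt)
  case base
  then show ?case by simp
next
  case (step c b y)
  have "(\<Sum>e\<in>B. ((b \<bullet> e) / (e \<bullet> e)) *\<^sub>R e) = (\<Sum>e\<in>B. if e = b then b else 0)"
    using assms(2) step(1)
    by (intro sum.cong refl) (auto simp: pairwise_def orthogonal_def)
  also have "\<dots> = b" using assms(1) step(1) by simp
  finally show ?case
    using step(2) by (simp add: inner_add_left add_divide_distrib scaleR_add_left sum.distrib
        flip: scaleR_sum_right scaleR_scaleR times_divide_eq_right)
qed

text \<open>Orthogonalise the image in H. By Cauchy-Schwarz each coordinate of
  \<open>\<iota> u\<close> is at most \<open>norm (\<iota> u) / norm e\<close>, and the expansion is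
  pulled back to U by injectivity.\<close>

lemma linear_bounded_below_on_finite_span:
  fixes \<iota> :: "'u::real_normed_vector \<Rightarrow> 'h::real_inner"
  assumes "linear \<iota>" "inj \<iota>" "finite B"
  obtains K where "\<And>u. u \<in> span B \<Longrightarrow> norm u \<le> K * norm (\<iota> u)"
proof -
  interpret linear \<iota> by fact
  obtain C where C: "finite C" "pairwise orthogonal C" "span C = span (\<iota> ` B)"
    using basis_orthogonal[of "\<iota> ` B"] assms(3) by blast
  define K where "K = (\<Sum>e\<in>C. norm (inv \<iota> e) / norm e)"
  have span: "span C = \<iota> ` span B" by (simp add: C(3) linear_span_image assms(1))
  have "norm u \<le> K * norm (\<iota> u)" if "u \<in> span B" for u
  proof -
    let ?c = "\<lambda>e. (\<iota> u \<bullet> e) / (e \<bullet> e)"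
    \<comment> \<open>The orthogonal vectors lie in the image of \<open>span B\<close>, so
      \<open>inv \<iota>\<close> is a right inverse on them.\<close>
    have e: "\<iota> (inv \<iota> e) = e" if "e \<in> C" for e
      using span_base[OF that] span by (auto simp: assms(2))
    have "\<iota> (\<Sum>e\<in>C. ?c e *\<^sub>R inv \<iota> e) = (\<Sum>e\<in>C. ?c e *\<^sub>R e)"
      by (simp add: sum scale e cong: sum.cong)
    also have "\<dots> = \<iota> u"
      using that by (intro orthogonal_expansion C) (simp add: span)
    finally have "u = (\<Sum>e\<in>C. ?c e *\<^sub>R inv \<iota> e)"
      using assms(2) by (simp add: inj_eq)
    then have "norm u \<le> (\<Sum>e\<in>C. \<bar>?c e\<bar> * norm (inv \<iota> e))"
      by (metis (no_types, lifting) norm_scaleR norm_sum sum.cong)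
    also have "\<dots> \<le> (\<Sum>e\<in>C. (norm (inv \<iota> e) / norm e) * norm (\<iota> u))"
    proof (rule sum_mono)
      fix e
      have "\<bar>?c e\<bar> \<le> norm (\<iota> u) / norm e"
        using Cauchy_Schwarz_ineq2[of "\<iota> u" e]
        by (cases "e = 0") (auto simp: divide_simps dot_square_norm power2_eq_square)
      then show "\<bar>?c e\<bar> * norm (inv \<iota> e) \<le> (norm (inv \<iota> e) / norm e) * norm (\<iota> u)"
        using mult_right_mono[of "\<bar>?c e\<bar>" "norm (\<iota> u) / norm e" "norm (inv \<iota> e)"]
        by (simp add: mult.commute)
    qed
    finally show ?thesis by (simp add: K_def sum_distrib_right)
  qed
  then show thesis by (rule that)
qed

text \<open>The real supremum \<open>mu\<close> dominates its quotients only if they are bounded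
  above; finite dimension provides the bound.\<close>

lemma norm_le_mu:
  fixes \<iota> :: "'u::real_normed_vector \<Rightarrow> 'h::real_inner"
  assumes "linear \<iota>" "inj \<iota>" "admissible_subspace Us" "u \<in> Us"
  shows "norm u \<le> mu \<iota> Us * norm (\<iota> u)"
proof (cases "u = 0")
  case False
  interpret linear \<iota> by fact
  obtain B where B: "finite B" "Us = span B"
    using assms(3) unfolding admissible_subspace_def by blast
  obtain K where K: "\<And>u. u \<in> Us \<Longrightarrow> norm u \<le> K * norm (\<iota> u)"
    using linear_bounded_below_on_finite_span[OF assms(1,2) B(1)] B(2) by blast
  have pos: "norm (\<iota> u) > 0" if "u \<noteq> 0" for u
    using that assms(2) zero by (metis inj_eq zero_less_norm_iff)
  have "norm u / norm (\<iota> u) \<le> mu \<iota> Us"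
    unfolding mu_def
  proof (rule cSUP_upper)
    show "bdd_above ((\<lambda>u. norm u / norm (\<iota> u)) ` (Us - {0}))"
      using K pos by (intro bdd_aboveI2[where M = K]) (auto simp: pos_divide_le_eq)
  qed (use False assms(4) in auto)
  then show ?thesis
    using pos[OF False] by (simp add: pos_divide_le_eq)
qed (use assms(1) in \<open>simp add: linear_0\<close>)

section \<open>Piecewise constant functions on the time grid\<close>

definition cell :: "real \<Rightarrow> nat \<Rightarrow> nat \<Rightarrow> real set" where
  "cell T N m = {node T N m<..<node T N (Suc m)}"

text \<open>No cell contains a node, so the value at the nodes is 0. The nodes form a null set, so
  this default affects no integral.\<close>

definition piecewise :: "real \<Rightarrow> nat \<Rightarrow> (nat \<Rightarrow> 'a::real_vector) \<Rightarrow> real \<Rightarrow> 'a" where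
  "piecewise T N c t = (\<Sum>m<N. indicat_real (cell T N m) t *\<^sub>R c m)"

locale time_grid =
  fixes T :: real and N :: nat
  assumes T_pos: "T > 0" and N_pos: "N \<ge> 1"
begin

abbreviation "k \<equiv> step T N"

lemma step_pos: "k > 0"
  using T_pos N_pos by (simp add: step_def)

lemma N_times_step: "real N * k = T"
  using N_pos by (simp add: step_def)

lemma node_0: "node T N 0 = 0" and node_N: "node T N N = T"
  by (simp_all add: node_def N_times_step)

lemma node_mono: "i \<le> j \<Longrightarrow> node T N i \<le> node T N j"
  using step_pos by (simp add: node_def)

lemma cell_subset: "m < N \<Longrightarrow> cell T N m \<subseteq> {0..T}"
  using node_mono[of 0 m] node_mono[of "Suc m" N] by (auto simp: cell_def node_0 node_N)

lemma cell_unique: "t \<in> cell T N i \<Longrightarrow> t \<in> cell T N j \<Longrightarrow> i = j"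
  using node_mono[of "Suc i" j] node_mono[of "Suc j" i]
  by (cases i j rule: linorder_cases) (auto simp: cell_def)

lemma grid_cases:
  assumes "t \<in> {0..T}"
  obtains m where "m \<le> N" "t = node T N m" | m where "m < N" "t \<in> cell T N m"
proof -
  \<comment> \<open>For \<open>t = T\<close> this gives \<open>m = N\<close>, which falls into the
    node case.\<close>
  define m where "m = nat \<lfloor>t / k\<rfloor>"
  have "real m \<le> t / k" "t / k < real m + 1"
    using assms step_pos by (auto simp: m_def)
  then have m: "node T N m \<le> t" "t < node T N (Suc m)"
    using step_pos by (auto simp: node_def field_simps)
  show thesis
  proof (cases "t = node T N m")
    case True
    have "node T N m \<le> node T N N" using m assms node_N by auto
    then have "m \<le> N" using step_pos by (simp add: node_def)
    from this True show ?thesis by (rule that)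
  next
    case False
    have "node T N m < node T N N" using m assms False node_N by auto
    then have "m < N" using step_pos by (simp add: node_def)
    with False m show ?thesis by (intro that(2)) (auto simp: cell_def)
  qed
qed

lemma piecewise_eq: "m < N \<Longrightarrow> t \<in> cell T N m \<Longrightarrow> piecewise T N c t = c m"
  by (subst piecewise_def, subst sum.remove[of _ m])
    (auto intro!: sum.neutral dest: cell_unique simp: indicator_def)

lemma sum_indicator_cell:
  fixes g :: "nat \<Rightarrow> 'a \<Rightarrow> real"
  shows "m < N \<Longrightarrow> t \<in> cell T N m \<Longrightarrow> (\<Sum>j<N. indicat_real (cell T N j) t * g j x) = g m x"
  using piecewise_eq[of m t "\<lambda>j. g j x"] by (simp add: piecewise_def)

lemma cell_sets: "m < N \<Longrightarrow> cell T N m \<in> sets (leb T)"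
  using cell_subset[of m] by (auto simp: cell_def sets_restrict_space_iff)

lemma measure_cell: "m < N \<Longrightarrow> measure (leb T) (cell T N m) = k"
  using cell_subset[of m] node_mono[of m "Suc m"]
  by (simp add: measure_restrict_space cell_def) (simp add: node_def algebra_simps)

lemma integral_indicator_cell:
  "m < N \<Longrightarrow> (\<integral>t. indicat_real (cell T N m) t * x \<partial>leb T) = k * x"
  using cell_subset[of m] by (simp add: measure_cell Int_absorb2)

lemma integrable_const_leb: "integrable (leb T) (\<lambda>t. x::real)"
proof -
  interpret finite_measure "leb T" by (rule finite_measure_lebesgue_on) simp
  show ?thesis by simp
qed

text \<open>Off the finitely many nodes, \<open>f\<close> equals the sum of the \<open>g m\<close>
  cut off to their cells, so \<open>f\<close> inherits measurability and integral. This also covers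
  \<open>a t (v t) (w t)\<close> for step functions \<open>v\<close> and \<open>w\<close>, where
  measurability is known only for fixed arguments of the form.\<close>

lemma
  fixes f :: "real \<Rightarrow> real"
  assumes g: "\<And>m. m < N \<Longrightarrow> integrable (leb T) (g m)"
    and f: "\<And>m t. m < N \<Longrightarrow> t \<in> cell T N m \<Longrightarrow> f t = g m t"
  shows integrable_cells: "integrable (leb T) f"
    and integral_cells: "(\<integral>t. f t \<partial>leb T) = (\<Sum>m<N. \<integral>t. indicat_real (cell T N m) t * g m t \<partial>leb T)"
proof -
  let ?X = "node T N ` {..N}" and ?s = "\<lambda>t. \<Sum>m<N. indicat_real (cell T N m) t * g m t"
  have X: "countable ?X" by simp
  have sets: "{x} \<in> sets (leb T)" and null: "emeasure (leb T) {x} = 0" if "x \<in> ?X" for x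
  proof -
    have "x \<in> {0..T}"
      using that node_mono[of 0] node_mono[of _ N] by (auto simp: node_0 node_N)
    then show "{x} \<in> sets (leb T)" "emeasure (leb T) {x} = 0"
      by (auto simp: sets_restrict_space_iff emeasure_restrict_space)
  qed
  have eq: "?s t = f t" if "t \<in> space (leb T)" "t \<notin> ?X" for t
  proof -
    obtain m where m: "m < N" "t \<in> cell T N m"
      using grid_cases[of t] \<open>t \<in> space (leb T)\<close> \<open>t \<notin> ?X\<close> by (auto simp: atMost_def)
    with sum_indicator_cell[of m t g t] f show ?thesis by simp
  qed
  have ig: "integrable (leb T) (\<lambda>t. indicat_real (cell T N m) t * g m t)" if "m < N" for m
    using integrable_real_mult_indicator[OF cell_sets[OF that] g[OF that]] by (simp add: mult.commute)
  then have "integrable (leb T) ?s"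
    by (intro Bochner_Integration.integrable_sum) auto
  then show "integrable (leb T) f"
    using integrable_discrete_difference[of ?X "leb T" ?s f] X null sets eq by blast
  show "(\<integral>t. f t \<partial>leb T) = (\<Sum>m<N. \<integral>t. indicat_real (cell T N m) t * g m t \<partial>leb T)"
  proof -
    have "(\<integral>t. f t \<partial>leb T) = (\<integral>t. ?s t \<partial>leb T)"
      by (rule integral_discrete_difference[OF X null sets eq, symmetric])
    also have "\<dots> = (\<Sum>m<N. \<integral>t. indicat_real (cell T N m) t * g m t \<partial>leb T)"
      by (rule Bochner_Integration.integral_sum) (use ig in auto)
    finally show ?thesis .
  qed
qed

lemma integral_cells_const:
  fixes f :: "real \<Rightarrow> real"
  assumes "\<And>m t. m < N \<Longrightarrow> t \<in> cell T N m \<Longrightarrow> f t = x m"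
  shows "(\<integral>t. f t \<partial>leb T) = k * (\<Sum>m<N. x m)"
  using integral_cells[of "\<lambda>m _. x m" f, OF integrable_const_leb assms]
  by (simp add: sum_distrib_left integral_indicator_cell del: Bochner_Integration.integral_mult_left
      Bochner_Integration.integral_mult_left_zero Bochner_Integration.integral_mult_right_zero integral_indicator)

lemma L2_norm_cells:
  assumes "\<And>m t. m < N \<Longrightarrow> t \<in> cell T N m \<Longrightarrow> f t = c m"
  shows "(L2_norm T f)\<^sup>2 = k * (\<Sum>m<N. (norm (c m))\<^sup>2)"
  using step_pos integral_cells_const[of "\<lambda>t. (norm (f t))\<^sup>2" "\<lambda>m. (norm (c m))\<^sup>2"] assms
  by (simp add: L2_norm_def sum_nonneg)

lemma piecewise_L2: "piecewise T N c \<in> L2 T"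
proof -
  have "simple_function (leb T) (piecewise T N c)"
    unfolding piecewise_def
    by (intro simple_function_sum simple_function_compose1[of _ _ "\<lambda>x. x *\<^sub>R _"] simple_function_indicator)
      (auto intro: cell_sets)
  then have "strongly_measurable (leb T) (piecewise T N c)"
    unfolding strongly_measurable_def by (intro exI[of _ "\<lambda>_. piecewise T N c"]) auto
  then show ?thesis
    using integrable_cells[of "\<lambda>m _. (norm (c m))\<^sup>2", OF integrable_const_leb]
    by (auto simp: L2_def piecewise_eq)
qed

section \<open>The space V_n and its orthogonal projection\<close>

lemma piecewise_V_space: "(\<And>m. m < N \<Longrightarrow> c m \<in> Us) \<Longrightarrow> piecewise T N c \<in> V_space T Us N"
  unfolding V_space_def by (auto simp: piecewise_L2 cell_def[symmetric] piecewise_eq intro!: exI[of _ c])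

lemma V_spaceE:
  assumes "v \<in> V_space T Us N"
  obtains c where "v \<in> L2 T" "\<And>m. m < N \<Longrightarrow> c m \<in> Us" "\<And>m t. m < N \<Longrightarrow> t \<in> cell T N m \<Longrightarrow> v t = c m"
  using assms unfolding V_space_def cell_def by blast

text \<open>Orthogonality in V becomes a statement on each cell. Only scalar integrals of
  \<open>v t \<bullet> d m\<close> occur, so no integral with values in U is formed.\<close>

lemma L2_inner_cells:
  assumes "v \<in> L2 T"
    and "\<And>m t. m < N \<Longrightarrow> t \<in> cell T N m \<Longrightarrow> y t = d m"
    and "\<And>m t. m < N \<Longrightarrow> t \<in> cell T N m \<Longrightarrow> p t = r m"
  shows "L2_inner T (\<lambda>t. v t - p t) y =
    (\<Sum>m<N. (\<integral>t. indicat_real (cell T N m) t * (v t \<bullet> d m) \<partial>leb T) - k * (r m \<bullet> d m))"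
proof -
  have I: "integrable (leb T) (\<lambda>t. v t \<bullet> d m)" for m
    by (rule L2_integrable_inner[OF assms(1)])
  have "L2_inner T (\<lambda>t. v t - p t) y =
      (\<Sum>m<N. \<integral>t. indicat_real (cell T N m) t * (v t \<bullet> d m - r m \<bullet> d m) \<partial>leb T)"
    unfolding L2_inner_def
    by (rule integral_cells) (auto intro!: Bochner_Integration.integrable_diff I integrable_const_leb
        simp: assms(2,3) inner_diff_left)
  also have "\<dots> = (\<Sum>m<N. (\<integral>t. indicat_real (cell T N m) t * (v t \<bullet> d m) \<partial>leb T) -
      (\<integral>t. indicat_real (cell T N m) t * (r m \<bullet> d m) \<partial>leb T))"
  proof (rule sum.cong[OF refl])
    fix m assume "m \<in> {..<N}"
    then have S: "cell T N m \<in> sets (leb T)" using cell_sets by simp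
    show "(\<integral>t. indicat_real (cell T N m) t * (v t \<bullet> d m - r m \<bullet> d m) \<partial>leb T) =
      (\<integral>t. indicat_real (cell T N m) t * (v t \<bullet> d m) \<partial>leb T) -
      (\<integral>t. indicat_real (cell T N m) t * (r m \<bullet> d m) \<partial>leb T)"
      unfolding right_diff_distrib
      using integrable_real_mult_indicator[OF S I] integrable_real_mult_indicator[OF S integrable_const_leb]
      by (intro Bochner_Integration.integral_diff) (simp_all only: mult.commute)
  qed
  finally show ?thesis by (simp add: integral_indicator_cell del: Bochner_Integration.integral_mult_left
      Bochner_Integration.integral_mult_left_zero Bochner_Integration.integral_mult_right_zero integral_indicator)
qed

text \<open>On each cell the projection is the mean of \<open>v\<close>, projected onto
  \<open>Us\<close>. Existence is what makes the choice in \<open>proj_V\<close> meaningful.\<close>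

lemma proj_V_exists:
  fixes v :: "real \<Rightarrow> 'u::real_inner"
  assumes "admissible_subspace Us" "v \<in> L2 T"
  shows "\<exists>p. p \<in> V_space T Us N \<and> (\<forall>y\<in>V_space T Us N. L2_inner T (\<lambda>t. v t - p t) y = 0)"
proof -
  obtain B where B: "finite B" "pairwise orthogonal B" "span B = Us"
    using assms(1) basis_orthogonal unfolding admissible_subspace_def by metis
  let ?I = "\<lambda>m u. \<integral>t. indicat_real (cell T N m) t * (v t \<bullet> u) \<partial>leb T"
  \<comment> \<open>Coordinates in the orthogonal basis: \<open>?I m e / k\<close> is the inner
    product of the cell mean of \<open>v\<close> with \<open>e\<close>.\<close>
  define r where "r m = (\<Sum>e\<in>B. (?I m e / k / (e \<bullet> e)) *\<^sub>R e)" for m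
  have r_Us: "r m \<in> Us" for m
    unfolding r_def B(3)[symmetric] by (intro span_sum span_scale span_base)
  have r: "k * (r m \<bullet> u) = ?I m u" if "u \<in> Us" "m < N" for m u
  proof -
    have u: "u = (\<Sum>e\<in>B. ((u \<bullet> e) / (e \<bullet> e)) *\<^sub>R e)"
      using orthogonal_expansion[OF B(1,2), of u] that B(3) by simp
    have "?I m u = (\<integral>t. (\<Sum>e\<in>B. ((u \<bullet> e) / (e \<bullet> e)) * (indicat_real (cell T N m) t * (v t \<bullet> e))) \<partial>leb T)"
      by (subst u) (simp add: inner_sum_right sum_distrib_left algebra_simps)
    also have "\<dots> = (\<Sum>e\<in>B. ((u \<bullet> e) / (e \<bullet> e)) * ?I m e)"
    proof (subst Bochner_Integration.integral_sum)
      fix e assume "e \<in> B"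
      have "integrable (leb T) (\<lambda>t. indicat_real (cell T N m) t * (v t \<bullet> e))"
        using integrable_real_mult_indicator[OF cell_sets L2_integrable_inner] that assms(2)
        by (simp add: mult.commute)
      then show "integrable (leb T) (\<lambda>t. ((u \<bullet> e) / (e \<bullet> e)) * (indicat_real (cell T N m) t * (v t \<bullet> e)))"
        by (rule integrable_mult_right)
    qed (auto intro!: sum.cong integral_mult_right_zero)
    also have "\<dots> = k * (r m \<bullet> u)"
      unfolding r_def inner_sum_left inner_scaleR_left sum_distrib_left
    proof (rule sum.cong[OF refl])
      show "(u \<bullet> e) / (e \<bullet> e) * I = k * (I / k / (e \<bullet> e) * (e \<bullet> u))" for e I
        using step_pos by (simp add: inner_commute)
    qed
    finally show ?thesis by simp
  qed
  show ?thesis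
  proof (intro exI[of _ "piecewise T N r"] conjI ballI)
    show "piecewise T N r \<in> V_space T Us N"
      using r_Us by (rule piecewise_V_space)
    fix y assume "y \<in> V_space T Us N"
    then obtain d where "y \<in> L2 T" and d: "\<And>m. m < N \<Longrightarrow> d m \<in> Us"
      "\<And>m t. m < N \<Longrightarrow> t \<in> cell T N m \<Longrightarrow> y t = d m"
      by (elim V_spaceE) (rule that; blast)
    have "L2_inner T (\<lambda>t. v t - piecewise T N r t) y =
        (\<Sum>m<N. ?I m (d m) - k * (r m \<bullet> d m))"
      by (rule L2_inner_cells[OF assms(2)]) (simp_all add: d(2) piecewise_eq)
    then show "L2_inner T (\<lambda>t. v t - piecewise T N r t) y = 0"
      by (simp add: r d(1))
  qed
qed

text \<open>\<open>proj_V\<close> is a choice, so it is accessed only through its characterisation: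
  constant values in \<open>Us\<close> on the cells, and the same inner products as \<open>v\<close>
  with all step functions in V_n.\<close>

lemma proj_V_cells:
  fixes v :: "real \<Rightarrow> 'u::real_inner"
  assumes "admissible_subspace Us" "v \<in> L2 T"
  obtains r where "\<And>m. m < N \<Longrightarrow> r m \<in> Us"
    "\<And>m t. m < N \<Longrightarrow> t \<in> cell T N m \<Longrightarrow> proj_V T Us N v t = r m"
    "\<And>d. (\<And>m. m < N \<Longrightarrow> d m \<in> Us) \<Longrightarrow> L2_inner T v (piecewise T N d) = k * (\<Sum>m<N. r m \<bullet> d m)"
proof -
  have p: "proj_V T Us N v \<in> V_space T Us N"
    and orth: "\<forall>y\<in>V_space T Us N. L2_inner T (\<lambda>t. v t - proj_V T Us N v t) y = 0"
    using someI_ex[OF proj_V_exists[OF assms]] unfolding proj_V_def by blast+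
  from p obtain r where "proj_V T Us N v \<in> L2 T" and r: "\<And>m. m < N \<Longrightarrow> r m \<in> Us"
    "\<And>m t. m < N \<Longrightarrow> t \<in> cell T N m \<Longrightarrow> proj_V T Us N v t = r m"
    by (elim V_spaceE) (rule that; blast)
  have "L2_inner T v (piecewise T N d) = k * (\<Sum>m<N. r m \<bullet> d m)" if d: "\<And>m. m < N \<Longrightarrow> d m \<in> Us" for d
  proof -
    have "L2_inner T (\<lambda>t. v t - proj_V T Us N v t) (piecewise T N d) = 0"
      using orth piecewise_V_space[of d Us] d by blast
    then show ?thesis
      \<comment> \<open>The second instance, with 0 in place of the projection, expands the inner
        product with \<open>v\<close> itself into the same cell integrals.\<close>
      using L2_inner_cells[OF assms(2), of "piecewise T N d" d "proj_V T Us N v" r] r(2)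
        L2_inner_cells[OF assms(2), of "piecewise T N d" d "\<lambda>_. 0" "\<lambda>_. 0"]
      by (simp add: sum_subtractf sum_distrib_left piecewise_eq)
  qed
  with r show thesis by (rule that)
qed

text \<open>Contractivity of the projection: the assumption says that the step function
  \<open>q\<close> with values \<open>r\<close> satisfies (v, q) = |q|^2, and (v, q) is at most
  (|v|^2 + |q|^2) / 2.\<close>

lemma proj_V_norm_le:
  fixes v :: "real \<Rightarrow> 'u::real_inner"
  assumes "v \<in> L2 T" "L2_inner T v (piecewise T N r) = k * (\<Sum>m<N. r m \<bullet> r m)"
  shows "k * (\<Sum>m<N. (norm (r m))\<^sup>2) \<le> (L2_norm T v)\<^sup>2"
proof -
  let ?q = "piecewise T N r"
  have q: "integrable (leb T) (\<lambda>t. (norm (?q t))\<^sup>2)"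
    and v: "integrable (leb T) (\<lambda>t. (norm (v t))\<^sup>2)"
    using piecewise_L2[of r] assms(1) by (auto simp: L2_def)
  have "L2_inner T v ?q \<le> (\<integral>t. ((norm (v t))\<^sup>2 + (norm (?q t))\<^sup>2) / 2 \<partial>leb T)"
    unfolding L2_inner_def
  proof (rule integral_mono)
    show "integrable (leb T) (\<lambda>t. v t \<bullet> ?q t)"
      by (rule integrable_cells[OF L2_integrable_inner[OF assms(1)]]) (simp add: piecewise_eq)
    show "integrable (leb T) (\<lambda>t. ((norm (v t))\<^sup>2 + (norm (?q t))\<^sup>2) / 2)"
      using q v by auto
    show "v t \<bullet> ?q t \<le> ((norm (v t))\<^sup>2 + (norm (?q t))\<^sup>2) / 2" for t
      using norm_cauchy_schwarz[of "v t" "?q t"] sum_squares_bound[of "norm (v t)" "norm (?q t)"] by simp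
  qed
  also have "\<dots> = ((L2_norm T v)\<^sup>2 + (L2_norm T ?q)\<^sup>2) / 2"
    using q v by (simp add: L2_norm_def)
  also have "(L2_norm T ?q)\<^sup>2 = k * (\<Sum>m<N. (norm (r m))\<^sup>2)"
    by (rule L2_norm_cells) (rule piecewise_eq)
  finally show ?thesis
    by (simp add: assms(2) power2_norm_eq_inner)
qed

text \<open>The values \<open>d\<close> and those of the projection have equal inner products with
  all step functions in V_n; test with their difference.\<close>

lemma proj_V_fixes_V_space:
  fixes v :: "real \<Rightarrow> 'u::real_inner"
  assumes "admissible_subspace Us" "v \<in> L2 T"
    and d: "\<And>m. m < N \<Longrightarrow> d m \<in> Us" "\<And>m t. m < N \<Longrightarrow> t \<in> cell T N m \<Longrightarrow> v t = d m"
    and "m < N" "t \<in> cell T N m"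
  shows "proj_V T Us N v t = d m"
proof -
  obtain r where r: "\<And>m. m < N \<Longrightarrow> r m \<in> Us"
    "\<And>m t. m < N \<Longrightarrow> t \<in> cell T N m \<Longrightarrow> proj_V T Us N v t = r m"
    and orth: "\<And>d. (\<And>m. m < N \<Longrightarrow> d m \<in> Us) \<Longrightarrow> L2_inner T v (piecewise T N d) = k * (\<Sum>m<N. r m \<bullet> d m)"
    using proj_V_cells[OF assms(1,2)] by blast
  have sub: "subspace Us" using assms(1) by (simp add: admissible_subspace_def)
  let ?e = "\<lambda>m. d m - r m"
  have "L2_inner T v (piecewise T N ?e) = k * (\<Sum>m<N. d m \<bullet> ?e m)"
    unfolding L2_inner_def by (rule integral_cells_const) (simp add: d(2) piecewise_eq)
  moreover have "L2_inner T v (piecewise T N ?e) = k * (\<Sum>m<N. r m \<bullet> ?e m)"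
    by (intro orth subspace_diff sub d(1) r(1))
  ultimately have "(\<Sum>m<N. ?e m \<bullet> ?e m) = 0"
    using step_pos by (simp add: inner_diff_left sum_subtractf)
  then have "?e m = 0"
    using \<open>m < N\<close> by (subst (asm) sum_nonneg_eq_0_iff) auto
  then show ?thesis using r(2) assms(5,6) by simp
qed

end

section \<open>Residual and stability estimates\<close>

text \<open>A single element of X_n is fixed. As \<open>w\<close> takes values in H, its nodal
  values are kept as vectors \<open>c m\<close> of U, where the form acts.\<close>

locale crank_nicolson_element = time_grid T N for T :: real and N :: nat +
  fixes \<iota> :: "'u::{real_inner,complete_space} \<Rightarrow> 'h::{real_inner,complete_space}"
    and C\<^sub>H M \<alpha> :: real and a :: "real \<Rightarrow> 'u \<Rightarrow> 'u \<Rightarrow> real" and \<Phi> :: "'h \<Rightarrow>\<^sub>L 'h" and Us :: "'u set"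
    and z :: "real \<Rightarrow> 'u \<Rightarrow>\<^sub>L real" and w :: "real \<Rightarrow> 'h" and c :: "nat \<Rightarrow> 'u"
  assumes alpha_pos: "\<alpha> > 0" and M_ge: "M \<ge> 1"
    and emb: "dense_embedding \<iota> C\<^sub>H" and form: "admissible_form T M \<alpha> a"
    and sub: "admissible_subspace Us" and Phi: "norm \<Phi> \<le> 1"
    and x: "(z, w) \<in> X_space (1/2) \<iota> T Us N"
    and c_Us: "\<And>m. m \<le> N \<Longrightarrow> c m \<in> Us" and w_node: "\<And>m. m \<le> N \<Longrightarrow> w (node T N m) = \<iota> (c m)"
    and w_cell: "\<And>m t. m < N \<Longrightarrow> t \<in> cell T N m \<Longrightarrow> w t = \<iota> ((1/2) *\<^sub>R (c (Suc m) + c m))"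
begin

sublocale linear \<iota>
  using emb by (simp add: dense_embedding_def)

lemma inj: "inj \<iota>" and C\<^sub>H_pos: "C\<^sub>H > 0" and iota_le: "norm (\<iota> v) \<le> C\<^sub>H * norm v"
  using emb by (auto simp: dense_embedding_def)

lemma subspace_Us: "subspace Us"
  using sub by (simp add: admissible_subspace_def)

definition mid :: "nat \<Rightarrow> 'u" where "mid m = (1/2) *\<^sub>R (c (Suc m) + c m)"

definition h :: "nat \<Rightarrow> 'h" where "h m = \<iota> (c m)"

definition A :: "nat \<Rightarrow> 'u \<Rightarrow> real" where
  "A m v = (\<integral>t. indicat_real (cell T N m) t * a t (mid m) v \<partial>leb T)"

text \<open>The form b at the step function with values \<open>d\<close> and at
  \<open>\<iota> u\<close>. The factor \<open>1 / k\<close> of the difference quotient has cancelled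
  against the cell length.\<close>

definition B :: "(nat \<Rightarrow> 'u) \<Rightarrow> 'u \<Rightarrow> real" where
  "B d u = (\<Sum>m<N. (h (Suc m) - h m) \<bullet> \<iota> (d m) + A m (d m)) + (h 0 - \<Phi> (h N)) \<bullet> \<iota> u"

definition S :: real where
  "S = (SUP y\<in>{y \<in> Y_space \<iota> T Us N. Y_norm T y = 1}. b_form \<iota> T a \<Phi> (z, w) y)"

definition W :: real where "W = k * (\<Sum>m<N. (norm (mid m))\<^sup>2)"

lemma W_nonneg: "W \<ge> 0"
  using step_pos by (simp add: W_def sum_nonneg)

lemma mid_Us: "m < N \<Longrightarrow> mid m \<in> Us"
  unfolding mid_def by (intro subspace_scale subspace_add subspace_Us c_Us) auto

lemma bilinear_a: "t \<in> {0..T} \<Longrightarrow> bilinear (a t)"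
  using form by (auto simp: admissible_form_def)

lemma a_bound: "AE t in leb T. \<forall>v w. \<bar>a t v w\<bar> \<le> M * norm v * norm w"
  using form by (auto simp: admissible_form_def)

lemma integrable_a: "integrable (leb T) (\<lambda>t. a t u v)"
proof -
  interpret finite_measure "leb T" by (rule finite_measure_lebesgue_on) simp
  show ?thesis
  proof (rule integrable_const_bound)
    show "AE t in leb T. norm (a t u v) \<le> M * norm u * norm v"
      using a_bound by eventually_elim auto
    show "(\<lambda>t. a t u v) \<in> borel_measurable (leb T)"
      using form by (auto simp: admissible_form_def)
  qed
qed

lemma integrable_cell_a:
  "m < N \<Longrightarrow> integrable (leb T) (\<lambda>t. indicat_real (cell T N m) t * a t u v)"
  using integrable_real_mult_indicator[OF cell_sets integrable_a] by (simp add: mult.commute)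

lemma integrable_cell_const:
  "m < N \<Longrightarrow> integrable (leb T) (\<lambda>t. indicat_real (cell T N m) t * x)"
  using integrable_real_mult_indicator[OF cell_sets integrable_const_leb] by (simp add: mult.commute)

lemma A_bound: assumes "m < N" shows "\<bar>A m v\<bar> \<le> k * (M * norm (mid m) * norm v)"
proof -
  have "\<bar>A m v\<bar> \<le> (\<integral>t. \<bar>indicat_real (cell T N m) t * a t (mid m) v\<bar> \<partial>leb T)"
    unfolding A_def by (rule integral_abs_bound)
  also have "\<dots> \<le> (\<integral>t. indicat_real (cell T N m) t * (M * norm (mid m) * norm v) \<partial>leb T)"
  proof (rule integral_mono_AE)
    show "AE t in leb T. \<bar>indicat_real (cell T N m) t * a t (mid m) v\<bar>
        \<le> indicat_real (cell T N m) t * (M * norm (mid m) * norm v)"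
      using a_bound by eventually_elim (simp add: abs_mult mult_left_mono)
  qed (use integrable_cell_a[OF assms] integrable_cell_const[OF assms] in auto)
  finally show ?thesis using integral_indicator_cell[OF assms] by metis
qed

lemma A_coercive: assumes "m < N" shows "k * (\<alpha> * (norm (mid m))\<^sup>2) \<le> A m (mid m)"
proof -
  have "(\<integral>t. indicat_real (cell T N m) t * (\<alpha> * (norm (mid m))\<^sup>2) \<partial>leb T) \<le> A m (mid m)"
    unfolding A_def
  proof (rule integral_mono)
    fix t assume "t \<in> space (leb T)"
    then have "\<alpha> * (norm (mid m))\<^sup>2 \<le> a t (mid m) (mid m)"
      using form by (auto simp: admissible_form_def)
    then show "indicat_real (cell T N m) t * (\<alpha> * (norm (mid m))\<^sup>2)
        \<le> indicat_real (cell T N m) t * a t (mid m) (mid m)"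
      by (simp add: mult_left_mono)
  qed (use integrable_cell_a[OF assms] integrable_cell_const[OF assms] in auto)
  then show ?thesis using integral_indicator_cell[OF assms] by metis
qed

lemma A_scale: "A m (s *\<^sub>R v) = s * A m v"
proof -
  have "A m (s *\<^sub>R v) = (\<integral>t. s * (indicat_real (cell T N m) t * a t (mid m) v) \<partial>leb T)"
    unfolding A_def
    by (rule Bochner_Integration.integral_cong[OF refl]) (simp add: bilinear_rmul[OF bilinear_a])
  then show ?thesis by (simp add: A_def)
qed

lemma B_scale: "B (\<lambda>m. s *\<^sub>R d m) (s *\<^sub>R u) = s * B d u"
  by (simp add: B_def scale A_scale sum_distrib_left distrib_left)

section \<open>Evaluation of b on the discrete spaces\<close>

lemma w_0: "w 0 = h 0" and w_T: "w T = h N"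
  using w_node[of 0] w_node[of N] by (simp_all add: node_0 node_N h_def)

lemma z_L2: "z \<in> L2 T" and z_pairing: "v \<in> L2 T \<Longrightarrow>
    dual_pairing T z v = L2_inner T (diff_quot T N w) (\<lambda>t. \<iota> (proj_V T Us N v t))"
  using x by (auto simp: X_space_def)

text \<open>Stated through the values of the projection because it serves both step functions and
  the Riesz representative of \<open>z\<close>.\<close>

lemma dual_pairing_cells:
  assumes "v \<in> L2 T" "\<And>m t. m < N \<Longrightarrow> t \<in> cell T N m \<Longrightarrow> proj_V T Us N v t = d m"
  shows "dual_pairing T z v = (\<Sum>m<N. (h (Suc m) - h m) \<bullet> \<iota> (d m))"
proof -
  have "diff_quot T N w t = (h (Suc m) - h m) /\<^sub>R k" if "m < N" "t \<in> cell T N m" for m t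
    using piecewise_eq[OF that, of "\<lambda>m. (w (node T N (Suc m)) - w (node T N m)) /\<^sub>R k"] that
    by (simp add: piecewise_def diff_quot_def cell_def[symmetric] w_node h_def)
  then have "dual_pairing T z v = k * (\<Sum>m<N. ((h (Suc m) - h m) /\<^sub>R k) \<bullet> \<iota> (d m))"
    unfolding z_pairing[OF assms(1)] L2_inner_def by (intro integral_cells_const) (simp add: assms(2))
  then show ?thesis
    using step_pos by (simp add: sum_distrib_left mult.assoc[symmetric])
qed

lemma to_V_cells: "m < N \<Longrightarrow> t \<in> cell T N m \<Longrightarrow> to_V \<iota> w t = mid m"
  using inj by (simp add: to_V_def w_cell mid_def)

lemma b_form_cells:
  assumes "v \<in> L2 T" "\<And>m. m < N \<Longrightarrow> d m \<in> Us" "\<And>m t. m < N \<Longrightarrow> t \<in> cell T N m \<Longrightarrow> v t = d m"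
  shows "b_form \<iota> T a \<Phi> (z, w) (v, \<iota> u) = B d u"
proof -
  have "dual_pairing T z v = (\<Sum>m<N. (h (Suc m) - h m) \<bullet> \<iota> (d m))"
    using proj_V_fixes_V_space[OF sub assms] by (intro dual_pairing_cells assms(1)) 
  moreover have "A_pairing T a (to_V \<iota> w) v = (\<Sum>m<N. A m (d m))"
    unfolding A_pairing_def A_def
    by (rule integral_cells[OF integrable_a]) (simp add: to_V_cells assms(3))
  ultimately show ?thesis
    by (simp add: b_form_def B_def w_0 w_T sum.distrib)
qed

lemma Y_norm_cells:
  assumes "\<And>m t. m < N \<Longrightarrow> t \<in> cell T N m \<Longrightarrow> v t = d m"
  shows "Y_norm T (v, \<iota> u) = sqrt (k * (\<Sum>m<N. (norm (d m))\<^sup>2) + (norm (\<iota> u))\<^sup>2)"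
  using L2_norm_cells[OF assms] by (simp add: Y_norm_def)

text \<open>Makes the real supremum \<open>S\<close> a genuine upper bound. Finiteness suffices, so
  the bound may depend on the grid: unit Y-norm limits each value \<open>d m\<close> by
  \<open>1 / sqrt k\<close>.\<close>

lemma bdd_above_b_form:
  "bdd_above (b_form \<iota> T a \<Phi> (z, w) ` {y \<in> Y_space \<iota> T Us N. Y_norm T y = 1})"
proof (rule bdd_aboveI2)
  fix y assume "y \<in> {y \<in> Y_space \<iota> T Us N. Y_norm T y = 1}"
  then obtain v u where y: "y = (v, \<iota> u)" and v: "v \<in> V_space T Us N" and Y: "Y_norm T (v, \<iota> u) = 1"
    by (auto simp: Y_space_def)
  from v obtain d where d: "v \<in> L2 T" "\<And>m. m < N \<Longrightarrow> d m \<in> Us"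
    "\<And>m t. m < N \<Longrightarrow> t \<in> cell T N m \<Longrightarrow> v t = d m"
    by (elim V_spaceE) (rule that; blast)
  have n: "k * (\<Sum>m<N. (norm (d m))\<^sup>2) + (norm (\<iota> u))\<^sup>2 = 1"
    using Y Y_norm_cells[of v d u] d(3) by simp
  have pos: "0 \<le> k * (\<Sum>m<N. (norm (d m))\<^sup>2)"
    using step_pos by (simp add: sum_nonneg)
  have u1: "norm (\<iota> u) \<le> 1"
    using n pos by (simp add: power2_le_imp_le[of _ 1])
  have d1: "norm (d m) \<le> 1 / sqrt k" if "m < N" for m
  proof -
    have "(norm (d m))\<^sup>2 \<le> (\<Sum>m<N. (norm (d m))\<^sup>2)"
      using that by (intro member_le_sum) auto
    also have "\<dots> \<le> 1 / k"
    proof -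
      have "k * (\<Sum>m<N. (norm (d m))\<^sup>2) \<le> 1"
        using n zero_le_power2[of "norm (\<iota> u)"] by linarith
      then show ?thesis using step_pos by (simp add: pos_le_divide_eq mult.commute)
    qed
    finally show ?thesis
      using real_le_rsqrt real_sqrt_divide by fastforce
  qed
  have "b_form \<iota> T a \<Phi> (z, w) y = B d u"
    unfolding y by (rule b_form_cells[OF d])
  also have "\<dots> \<le> (\<Sum>m<N. norm (h (Suc m) - h m) * (C\<^sub>H * (1 / sqrt k)) + k * (M * norm (mid m) * (1 / sqrt k)))
      + norm (h 0 - \<Phi> (h N)) * 1"
    unfolding B_def
  proof (intro add_mono sum_mono)
    fix m assume "m \<in> {..<N}"
    then have m: "m < N" by simp
    have "(h (Suc m) - h m) \<bullet> \<iota> (d m) \<le> norm (h (Suc m) - h m) * norm (\<iota> (d m))"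
      by (rule norm_cauchy_schwarz)
    also have "norm (\<iota> (d m)) \<le> C\<^sub>H * (1 / sqrt k)"
      using iota_le[of "d m"] mult_left_mono[OF d1[OF m], of C\<^sub>H] C\<^sub>H_pos by linarith
    finally show "(h (Suc m) - h m) \<bullet> \<iota> (d m) \<le> norm (h (Suc m) - h m) * (C\<^sub>H * (1 / sqrt k))"
      by (simp add: mult_left_mono)
    have "A m (d m) \<le> k * (M * norm (mid m) * norm (d m))"
      using A_bound[OF m, of "d m"] by simp
    also have "\<dots> \<le> k * (M * norm (mid m) * (1 / sqrt k))"
      using step_pos M_ge by (intro mult_left_mono d1 m) auto
    finally show "A m (d m) \<le> k * (M * norm (mid m) * (1 / sqrt k))" .
  next
    have "(h 0 - \<Phi> (h N)) \<bullet> \<iota> u \<le> norm (h 0 - \<Phi> (h N)) * norm (\<iota> u)"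
      by (rule norm_cauchy_schwarz)
    also have "\<dots> \<le> norm (h 0 - \<Phi> (h N)) * 1"
      using u1 by (intro mult_left_mono) auto
    finally show "(h 0 - \<Phi> (h N)) \<bullet> \<iota> u \<le> norm (h 0 - \<Phi> (h N)) * 1" .
  qed
  finally show "b_form \<iota> T a \<Phi> (z, w) y \<le> (\<Sum>m<N. norm (h (Suc m) - h m) * (C\<^sub>H * (1 / sqrt k)) +
      k * (M * norm (mid m) * (1 / sqrt k))) + norm (h 0 - \<Phi> (h N)) * 1" .
qed

text \<open>Homogeneity extends the bound from the unit sphere to all test pairs. If the norm is 0,
  then \<open>d\<close> vanishes on all cells and \<open>\<iota> u = 0\<close>, so both sides are
  0.\<close>

lemma residual:
  assumes d: "\<And>m. m < N \<Longrightarrow> d m \<in> Us" and u: "u \<in> Us"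
  shows "B d u \<le> S * sqrt (k * (\<Sum>m<N. (norm (d m))\<^sup>2) + (norm (\<iota> u))\<^sup>2)"
proof -
  define n where "n = sqrt (k * (\<Sum>m<N. (norm (d m))\<^sup>2) + (norm (\<iota> u))\<^sup>2)"
  have pos: "0 \<le> k * (\<Sum>m<N. (norm (d m))\<^sup>2)"
    using step_pos by (simp add: sum_nonneg)
  show ?thesis
  proof (cases "n = 0")
    case True
    then have "k * (\<Sum>m<N. (norm (d m))\<^sup>2) = 0 \<and> (norm (\<iota> u))\<^sup>2 = 0"
      unfolding n_def using pos by (simp add: add_nonneg_eq_0_iff)
    then have "(\<Sum>m<N. (norm (d m))\<^sup>2) = 0" and u0: "\<iota> u = 0"
      using step_pos by auto
    then have "d m = 0" if "m < N" for m
      using that by (subst (asm) sum_nonneg_eq_0_iff) auto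
    moreover have "A m 0 = 0" for m using A_scale[of m 0 0] by simp
    ultimately have "B d u = 0" by (simp add: B_def u0 zero)
    then show ?thesis using True n_def by simp
  next
    case False
    then have n: "n > 0" using pos by (simp add: n_def less_le)
    let ?d = "\<lambda>m. (1/n) *\<^sub>R d m" and ?u = "(1/n) *\<^sub>R u"
    have d': "m < N \<Longrightarrow> ?d m \<in> Us" for m
      by (intro subspace_scale subspace_Us d)
    have "(\<Sum>m<N. (norm (?d m))\<^sup>2) = (\<Sum>m<N. (norm (d m))\<^sup>2) / n\<^sup>2"
      using n by (simp add: power_divide sum_divide_distrib)
    then have "k * (\<Sum>m<N. (norm (?d m))\<^sup>2) + (norm (\<iota> ?u))\<^sup>2
        = (k * (\<Sum>m<N. (norm (d m))\<^sup>2) + (norm (\<iota> u))\<^sup>2) / n\<^sup>2"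
      using n by (simp add: scale power_divide add_divide_distrib)
    also have "\<dots> = 1"
      using n pos by (simp add: n_def)
    finally have one: "k * (\<Sum>m<N. (norm (?d m))\<^sup>2) + (norm (\<iota> ?u))\<^sup>2 = 1" .
    have "Y_norm T (piecewise T N ?d, \<iota> ?u) = sqrt (k * (\<Sum>m<N. (norm (?d m))\<^sup>2) + (norm (\<iota> ?u))\<^sup>2)"
      by (rule Y_norm_cells) (rule piecewise_eq)
    then have "Y_norm T (piecewise T N ?d, \<iota> ?u) = 1"
      by (simp only: one real_sqrt_one)
    moreover have "(piecewise T N ?d, \<iota> ?u) \<in> Y_space \<iota> T Us N"
      using piecewise_V_space[OF d'] subspace_scale[OF subspace_Us u] by (simp add: Y_space_def)
    ultimately have "b_form \<iota> T a \<Phi> (z, w) (piecewise T N ?d, \<iota> ?u) \<le> S"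
      unfolding S_def by (intro cSUP_upper bdd_above_b_form) auto
    moreover have "b_form \<iota> T a \<Phi> (z, w) (piecewise T N ?d, \<iota> ?u) = B ?d ?u"
      by (rule b_form_cells) (simp_all add: piecewise_L2 d' piecewise_eq)
    ultimately have "(1/n) * B d u \<le> S"
      by (simp only: B_scale)
    then show ?thesis
      using n by (simp add: n_def[symmetric] pos_divide_le_eq)
  qed
qed

section \<open>Energy, periodicity and dual norm estimates\<close>

lemma S_nonneg: "S \<ge> 0"
proof -
  \<comment> \<open>A nonzero test vector exists since U_n is not trivial; \<open>u\<close> and
    \<open>- u\<close> give opposite values, so the supremum cannot be negative.\<close>
  obtain u where u: "u \<in> Us" "u \<noteq> 0"
    using sub subspace_0[OF subspace_Us] by (auto simp: admissible_subspace_def)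
  have "B (\<lambda>_. 0) u \<le> S * norm (\<iota> u)" "B (\<lambda>_. 0) (- u) \<le> S * norm (\<iota> u)"
    using residual[of "\<lambda>_. 0" u] residual[of "\<lambda>_. 0" "- u"] u subspace_0[OF subspace_Us]
      subspace_neg[OF subspace_Us u(1)] by (simp_all add: neg)
  moreover have "B (\<lambda>_. 0) (- u) = - B (\<lambda>_. 0) u"
    using B_scale[of "-1" "\<lambda>_. 0" u] by simp
  ultimately have "0 \<le> S * norm (\<iota> u)" by linarith
  moreover have "norm (\<iota> u) > 0"
    using u inj zero by (metis inj_eq zero_less_norm_iff)
  ultimately show ?thesis by (simp add: zero_le_mult_iff)
qed

text \<open>Step functions may be cut off in time, so the midpoints restricted to the cells from
  \<open>i\<close> to \<open>j\<close> are admissible. With \<theta> = 1/2 the increment times the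
  midpoint is exactly half the difference of squared nodal norms, hence the sum telescopes.\<close>

lemma energy_estimate:
  assumes "i \<le> j" "j \<le> N"
  shows "(norm (h j))\<^sup>2 + \<alpha> * (k * (\<Sum>m=i..<j. (norm (mid m))\<^sup>2)) \<le> (norm (h i))\<^sup>2 + S\<^sup>2 / \<alpha>"
proof -
  define X where "X = k * (\<Sum>m=i..<j. (norm (mid m))\<^sup>2)"
  define d where "d m = (if i \<le> m \<and> m < j then mid m else 0)" for m
  have X: "X \<ge> 0" using step_pos by (simp add: X_def sum_nonneg)
  have restrict: "(\<Sum>m<N. f m) = (\<Sum>m=i..<j. g m)"
    if "\<And>m. i \<le> m \<Longrightarrow> m < j \<Longrightarrow> f m = g m" "\<And>m. \<not> (i \<le> m \<and> m < j) \<Longrightarrow> f m = 0" for f g :: "nat \<Rightarrow> real"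
    using assms that by (intro sum.mono_neutral_cong_right) auto
  have A0: "A m 0 = 0" for m using A_scale[of m 0 0] by simp
  have term_eq: "(h (Suc m) - h m) \<bullet> \<iota> (mid m) = ((norm (h (Suc m)))\<^sup>2 - (norm (h m))\<^sup>2) / 2" for m
    by (simp add: mid_def h_def scale add power2_norm_eq_inner inner_diff inner_add inner_commute field_simps)
  have "(\<Sum>m=i..<j. ((norm (h (Suc m)))\<^sup>2 - (norm (h m))\<^sup>2) / 2) = ((norm (h j))\<^sup>2 - (norm (h i))\<^sup>2) / 2"
    using sum_Suc_diff'[OF assms(1), of "\<lambda>m. (norm (h m))\<^sup>2"] by (simp flip: sum_divide_distrib)
  moreover have "\<alpha> * X \<le> (\<Sum>m=i..<j. A m (mid m))"
    unfolding X_def sum_distrib_left using A_coercive assms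
    by (intro sum_mono) (simp add: algebra_simps)
  moreover have "B d 0 = (\<Sum>m=i..<j. ((norm (h (Suc m)))\<^sup>2 - (norm (h m))\<^sup>2) / 2 + A m (mid m))"
    unfolding B_def by (subst restrict) (auto simp: d_def zero A0 term_eq)
  ultimately have "((norm (h j))\<^sup>2 - (norm (h i))\<^sup>2) / 2 + \<alpha> * X \<le> B d 0"
    unfolding sum.distrib by linarith
  also have "\<dots> \<le> S * sqrt (k * (\<Sum>m<N. (norm (d m))\<^sup>2) + (norm (\<iota> 0))\<^sup>2)"
    by (rule residual) (auto simp: d_def mid_Us subspace_0[OF subspace_Us])
  also have "\<dots> = S * sqrt X"
    unfolding X_def by (subst restrict) (auto simp: d_def zero)
  \<comment> \<open>Young's inequality with weight \<open>sqrt \<alpha>\<close>: the part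
    \<open>\<alpha> * X / 2\<close> is absorbed by the coercive term on the left.\<close>
  also have "\<dots> \<le> (S\<^sup>2 / \<alpha> + \<alpha> * X) / 2"
  proof -
    have "2 * (S / sqrt \<alpha>) * (sqrt \<alpha> * sqrt X) \<le> (S / sqrt \<alpha>)\<^sup>2 + (sqrt \<alpha> * sqrt X)\<^sup>2"
      by (rule sum_squares_bound)
    then show ?thesis
      using alpha_pos X by (simp add: power_divide power_mult_distrib)
  qed
  finally show ?thesis by (simp add: X_def field_simps)
qed

lemma periodicity_estimate: "norm (h 0) \<le> norm \<Phi> * norm (h N) + S"
proof -
  have "(h 0 - \<Phi> (h N)) \<bullet> h 0 \<le> S * norm (h 0)"
    using residual[of "\<lambda>_. 0" "c 0"] c_Us[of 0] subspace_0[OF subspace_Us] A_scale[of _ 0 0]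
    by (simp add: B_def zero h_def)
  moreover have "\<Phi> (h N) \<bullet> h 0 \<le> (norm \<Phi> * norm (h N)) * norm (h 0)"
    using norm_cauchy_schwarz[of "\<Phi> (h N)" "h 0"] 
      mult_right_mono[OF norm_blinfun[of \<Phi> "h N"] norm_ge_zero, of "h 0"]
    by linarith
  ultimately have "norm (h 0) * norm (h 0) \<le> (norm \<Phi> * norm (h N) + S) * norm (h 0)"
    by (simp add: inner_diff_left dot_square_norm power2_eq_square distrib_right)
  then show ?thesis
    using S_nonneg by (cases "h 0 = 0") auto
qed

definition E :: real where "E = S + M * sqrt W"

lemma E_nonneg: "E \<ge> 0"
  using S_nonneg M_ge W_nonneg by (simp add: E_def)

text \<open>Test with \<open>(d, 0)\<close>, move the form to the right and apply Cauchy-Schwarz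
  there: \<open>E\<close> bounds the discrete derivative as a functional on V_n.\<close>

lemma difference_estimate:
  assumes d: "\<And>m. m < N \<Longrightarrow> d m \<in> Us"
  shows "(\<Sum>m<N. (h (Suc m) - h m) \<bullet> \<iota> (d m)) \<le> E * sqrt (k * (\<Sum>m<N. (norm (d m))\<^sup>2))"
proof -
  let ?D = "\<Sum>m<N. (norm (d m))\<^sup>2"
  have "(\<Sum>m<N. norm (mid m) * norm (d m)) \<le> L2_set (\<lambda>m. norm (mid m)) {..<N} * L2_set (\<lambda>m. norm (d m)) {..<N}"
    using L2_set_mult_ineq[of "\<lambda>m. norm (mid m)" "\<lambda>m. norm (d m)" "{..<N}"] by simp
  then have "k * (\<Sum>m<N. norm (mid m) * norm (d m)) \<le> (sqrt k * sqrt k) * (sqrt (\<Sum>m<N. (norm (mid m))\<^sup>2) * sqrt ?D)"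
    using step_pos by (simp add: L2_set_def)
  also have "\<dots> = sqrt W * sqrt (k * ?D)"
    by (simp add: W_def real_sqrt_mult algebra_simps)
  finally have CS: "M * (k * (\<Sum>m<N. norm (mid m) * norm (d m))) \<le> M * (sqrt W * sqrt (k * ?D))"
    using M_ge by (intro mult_left_mono) auto
  have "- (\<Sum>m<N. A m (d m)) \<le> (\<Sum>m<N. k * (M * norm (mid m) * norm (d m)))"
    unfolding sum_negf[symmetric]
  proof (rule sum_mono)
    show "- A m (d m) \<le> k * (M * norm (mid m) * norm (d m))" if "m \<in> {..<N}" for m
      using A_bound[of m "d m"] that by simp
  qed
  also have "\<dots> = M * (k * (\<Sum>m<N. norm (mid m) * norm (d m)))"
    by (simp add: sum_distrib_left algebra_simps)
  finally have "- (\<Sum>m<N. A m (d m)) \<le> M * (sqrt W * sqrt (k * ?D))"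
    using CS by linarith
  moreover have "(\<Sum>m<N. (h (Suc m) - h m) \<bullet> \<iota> (d m)) + (\<Sum>m<N. A m (d m)) \<le> S * sqrt (k * ?D)"
    using residual[of d 0] d subspace_0[OF subspace_Us] by (simp add: B_def zero sum.distrib)
  ultimately show ?thesis
    by (simp add: E_def algebra_simps)
qed

text \<open>Pair \<open>z\<close> with its Riesz representative to get the squared norm. As
  \<open>z\<close> acts through the projection, the bound on V_n applies, and contractivity returns
  to the norm of \<open>z\<close>.\<close>

lemma norm_z_le: "L2_norm T z \<le> E"
proof -
  obtain r where r: "r \<in> L2 T" "\<And>t. norm (r t) = norm (z t)" "\<And>t v. blinfun_apply (z t) v = r t \<bullet> v"
    using L2_riesz[OF z_L2] by blast
  have norm_r: "L2_norm T r = L2_norm T z"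
    by (simp add: L2_norm_def r(2))
  obtain p where p: "\<And>m. m < N \<Longrightarrow> p m \<in> Us"
    "\<And>m t. m < N \<Longrightarrow> t \<in> cell T N m \<Longrightarrow> proj_V T Us N r t = p m"
    "\<And>d. (\<And>m. m < N \<Longrightarrow> d m \<in> Us) \<Longrightarrow> L2_inner T r (piecewise T N d) = k * (\<Sum>m<N. p m \<bullet> d m)"
    using proj_V_cells[OF sub r(1)] by blast
  have norm_nonneg: "L2_norm T z \<ge> 0"
    by (simp add: L2_norm_def)
  have "(L2_norm T z)\<^sup>2 = dual_pairing T z r"
    by (simp add: L2_norm_def dual_pairing_def r(3) r(2)[symmetric] power2_norm_eq_inner)
  also have "\<dots> = (\<Sum>m<N. (h (Suc m) - h m) \<bullet> \<iota> (p m))"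
    by (rule dual_pairing_cells[OF r(1) p(2)])
  also have "\<dots> \<le> E * sqrt (k * (\<Sum>m<N. (norm (p m))\<^sup>2))"
    by (rule difference_estimate[OF p(1)])
  also have "\<dots> \<le> E * L2_norm T z"
    using proj_V_norm_le[OF r(1) p(3)[OF p(1)]] norm_nonneg E_nonneg
    by (intro mult_left_mono real_le_lsqrt) (simp_all add: norm_r)
  finally have "L2_norm T z * L2_norm T z \<le> E * L2_norm T z"
    by (simp add: power2_eq_square)
  then show ?thesis
    using norm_nonneg E_nonneg by (cases "L2_norm T z = 0") auto
qed

text \<open>Inside a cell \<open>w\<close> is the mean of two neighbouring nodal values, so nodal
  bounds control the supremum over all times.\<close>

lemma G_norm_le:
  assumes "\<And>m. m \<le> N \<Longrightarrow> norm (h m) \<le> R"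
  shows "(G_norm \<iota> T w)\<^sup>2 \<le> R\<^sup>2 + W"
proof -
  have "norm (w t) \<le> R" if "t \<in> {0..T}" for t
    using that
  proof (cases rule: grid_cases)
    case (1 m)
    then show ?thesis using assms w_node by (simp add: h_def)
  next
    case (2 m)
    then have "w t = (1/2) *\<^sub>R (h (Suc m) + h m)"
      using w_cell by (simp add: scale add h_def)
    then show ?thesis
      using 2 assms[of m] assms[of "Suc m"] norm_triangle_ineq[of "h (Suc m)" "h m"] by simp
  qed
  then have "(SUP t\<in>{0..T}. (norm (w t))\<^sup>2) \<le> R\<^sup>2"
    using T_pos by (intro cSUP_least) (auto intro: power_mono)
  \<comment> \<open>Needed to square the root in \<open>G_norm\<close>: its radicand must be
    nonnegative.\<close>
  moreover have "(0::real) \<le> (SUP t\<in>{0..T}. (norm (w t))\<^sup>2)"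
  proof -
    have "bdd_above ((\<lambda>t. (norm (w t))\<^sup>2) ` {0..T})"
      using \<open>\<And>t. t \<in> {0..T} \<Longrightarrow> norm (w t) \<le> R\<close> by (intro bdd_aboveI2[of _ _ "R\<^sup>2"] power_mono) auto
    then have "(norm (w 0))\<^sup>2 \<le> (SUP t\<in>{0..T}. (norm (w t))\<^sup>2)"
      using T_pos by (intro cSUP_upper) auto
    then show ?thesis by (rule order_trans[rotated]) simp
  qed
  moreover have "(L2_norm T (to_V \<iota> w))\<^sup>2 = W"
    unfolding W_def by (rule L2_norm_cells) (rule to_V_cells)
  ultimately show ?thesis
    using W_nonneg by (simp add: G_norm_def)
qed

section \<open>The norm of Z in terms of S\<close>

lemma E_square_le: "E\<^sup>2 \<le> 2 * S\<^sup>2 + 2 * M\<^sup>2 * W"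
  using sum_squares_bound[of S "M * sqrt W"] W_nonneg
  by (simp add: E_def power2_sum power_mult_distrib mult.commute mult.left_commute)

text \<open>Reduces both cases to bounds on the final value and on \<open>W\<close>. The final value
  controls the initial one, and the energy estimate started at 0 controls all nodes. The 4 collects
  \<open>2 * S\<^sup>2\<close> from \<open>E\<^sup>2\<close> and from \<open>h 0\<close>
  each.\<close>

lemma Z_norm_le:
  assumes "(norm (h N))\<^sup>2 \<le> P * S\<^sup>2" "W \<le> Q * S\<^sup>2"
  shows "Z_norm \<iota> T (z, w) \<le> sqrt (4 + 2 * P + 1 / \<alpha> + (2 * M\<^sup>2 + 1) * Q) * S"
proof -
  have h0: "(norm (h 0))\<^sup>2 \<le> 2 * P * S\<^sup>2 + 2 * S\<^sup>2"
  proof -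
    have "norm \<Phi> * norm (h N) \<le> norm (h N)"
      using Phi by (simp add: mult_left_le_one_le)
    then have "(norm (h 0))\<^sup>2 \<le> (norm (h N) + S)\<^sup>2"
      using periodicity_estimate by (intro power_mono) auto
    also have "\<dots> \<le> 2 * (norm (h N))\<^sup>2 + 2 * S\<^sup>2"
      using sum_squares_bound[of "norm (h N)" S] by (simp add: power2_sum)
    finally show ?thesis using assms(1) by simp
  qed
  define R where "R = sqrt (2 * P * S\<^sup>2 + 2 * S\<^sup>2 + S\<^sup>2 / \<alpha>)"
  have h_sq: "(norm (h m))\<^sup>2 \<le> 2 * P * S\<^sup>2 + 2 * S\<^sup>2 + S\<^sup>2 / \<alpha>" if "m \<le> N" for m
  proof -
    have "0 \<le> \<alpha> * (k * (\<Sum>i=0..<m. (norm (mid i))\<^sup>2))"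
      using alpha_pos step_pos by (simp add: sum_nonneg)
    then show ?thesis using energy_estimate[of 0 m] that h0 by linarith
  qed
  then have "(G_norm \<iota> T w)\<^sup>2 \<le> R\<^sup>2 + W"
    by (intro G_norm_le) (auto simp: R_def intro: real_le_rsqrt)
  \<comment> \<open>No sign of \<open>P\<close> is assumed; the radicand is nonnegative because it
    dominates the square of \<open>norm (h 0)\<close>.\<close>
  also have "R\<^sup>2 = 2 * P * S\<^sup>2 + 2 * S\<^sup>2 + S\<^sup>2 / \<alpha>"
    using h_sq[of 0] zero_le_power2[of "norm (h 0)"] unfolding R_def by (intro real_sqrt_pow2) linarith
  finally have G: "(G_norm \<iota> T w)\<^sup>2 \<le> 2 * P * S\<^sup>2 + 2 * S\<^sup>2 + S\<^sup>2 / \<alpha> + W" .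
  have "(L2_norm T z)\<^sup>2 \<le> E\<^sup>2"
    using norm_z_le by (intro power_mono) (auto simp: L2_norm_def)
  moreover have "(2 * M\<^sup>2 + 1) * W \<le> (2 * M\<^sup>2 + 1) * (Q * S\<^sup>2)"
    using assms(2) by (intro mult_left_mono) auto
  ultimately have "(L2_norm T z)\<^sup>2 + (G_norm \<iota> T w)\<^sup>2 \<le> (4 + 2 * P + 1 / \<alpha> + (2 * M\<^sup>2 + 1) * Q) * S\<^sup>2"
    using G E_square_le by (simp add: algebra_simps)
  then have "Z_norm \<iota> T (z, w) \<le> sqrt ((4 + 2 * P + 1 / \<alpha> + (2 * M\<^sup>2 + 1) * Q) * S\<^sup>2)"
    by (simp add: Z_norm_def)
  then show ?thesis
    using S_nonneg by (simp add: real_sqrt_mult)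
qed

lemma energy_total: "(norm (h N))\<^sup>2 + \<alpha> * W \<le> (norm (h 0))\<^sup>2 + S\<^sup>2 / \<alpha>"
  using energy_estimate[of 0 N] by (simp add: W_def atLeast0LessThan)

text \<open>\<open>\<phi> * p + S\<close> is the convex combination of \<open>p\<close> and
  \<open>S / (1 - \<phi>)\<close> with weights \<open>\<phi>\<close> and \<open>1 - \<phi>\<close>.
  Convexity of the square then leaves \<open>(1 - \<phi>) * p\<^sup>2\<close> on the left of the
  total energy balance.\<close>

lemma Z_norm_le_contraction:
  assumes "norm \<Phi> < 1"
  shows "Z_norm \<iota> T (z, w) \<le> sqrt (4 + 2 * ((1 / (1 - norm \<Phi>) + 1 / \<alpha>) / (1 - norm \<Phi>)) + 1 / \<alpha> +
    (2 * M\<^sup>2 + 1) * ((1 / (1 - norm \<Phi>) + 1 / \<alpha>) / \<alpha>)) * S"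
proof -
  define \<phi> where "\<phi> = norm \<Phi>"
  have \<phi>: "0 \<le> \<phi>" "\<phi> < 1" using assms by (auto simp: \<phi>_def)
  let ?p = "norm (h N)" and ?D = "1 / (1 - \<phi>) + 1 / \<alpha>"
  have "(norm (h 0))\<^sup>2 \<le> (\<phi> * ?p + S)\<^sup>2"
    using periodicity_estimate by (intro power_mono) (auto simp: \<phi>_def)
  also have "\<dots> \<le> \<phi> * ?p\<^sup>2 + S\<^sup>2 / (1 - \<phi>)"
  proof -
    define s where "s = S / (1 - \<phi>)"
    have S: "S = (1 - \<phi>) * s" "S\<^sup>2 / (1 - \<phi>) = (1 - \<phi>) * s\<^sup>2"
      using \<phi> by (simp_all add: s_def power2_eq_square)
    have "\<phi> * ?p\<^sup>2 + S\<^sup>2 / (1 - \<phi>) - (\<phi> * ?p + S)\<^sup>2 = \<phi> * (1 - \<phi>) * (?p - s)\<^sup>2"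
      unfolding S(2) by (subst S(1)) (simp add: algebra_simps power2_eq_square)
    also have "\<dots> \<ge> 0" using \<phi> by simp
    finally show ?thesis by simp
  qed
  finally have "(1 - \<phi>) * ?p\<^sup>2 + \<alpha> * W \<le> ?D * S\<^sup>2"
    using energy_total by (simp add: algebra_simps)
  moreover have "0 \<le> (1 - \<phi>) * ?p\<^sup>2" "0 \<le> \<alpha> * W"
    using \<phi> alpha_pos W_nonneg by auto
  ultimately have "(1 - \<phi>) * ?p\<^sup>2 \<le> ?D * S\<^sup>2" "\<alpha> * W \<le> ?D * S\<^sup>2"
    by linarith+
  then have "?p\<^sup>2 \<le> ?D / (1 - \<phi>) * S\<^sup>2" "W \<le> ?D / \<alpha> * S\<^sup>2"
    using \<phi> alpha_pos by (simp_all add: pos_le_divide_eq mult.commute)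
  from Z_norm_le[OF this] show ?thesis by (simp add: \<phi>_def)
qed

text \<open>
  Without a contraction, control of the midpoints does not suffice: the increments
  \<open>h (m + 1) - h m\<close> are tested with themselves, and \<open>\<mu>\<close> converts the U-norm into the H-norm.
\<close>

lemma increment_estimate:
  assumes "k * mu \<iota> Us \<le> C" "C > 0"
  shows "k * (\<Sum>m<N. (norm (h (Suc m) - h m))\<^sup>2) \<le> C\<^sup>2 * E\<^sup>2"
proof -
  define Q where "Q = (\<Sum>m<N. (norm (h (Suc m) - h m))\<^sup>2)"
  have Q: "Q \<ge> 0" by (simp add: Q_def sum_nonneg)
  let ?d = "\<lambda>m. c (Suc m) - c m"
  have iota_d: "\<iota> (?d m) = h (Suc m) - h m" for m by (simp add: h_def diff)
  have d: "?d m \<in> Us" if "m < N" for m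
    using that by (intro subspace_diff subspace_Us c_Us) auto
  \<comment> \<open>The inverse inequality, where one factor \<open>k\<close> is traded for
    \<open>C\<close>; this is the only use of the coupling of \<open>k\<close> and
    \<open>mu\<close>.\<close>
  have kd: "k * norm (?d m) \<le> C * norm (h (Suc m) - h m)" if "m < N" for m
  proof -
    have "k * norm (?d m) \<le> k * (mu \<iota> Us * norm (h (Suc m) - h m))"
      using norm_le_mu[OF linear_axioms inj sub d[OF that]] step_pos by (simp add: iota_d)
    also have "\<dots> \<le> C * norm (h (Suc m) - h m)"
      using mult_right_mono[OF assms(1)] by (simp add: mult.assoc)
    finally show ?thesis .
  qed
  have "k\<^sup>2 * (\<Sum>m<N. (norm (?d m))\<^sup>2) \<le> C\<^sup>2 * Q"
    unfolding Q_def sum_distrib_left power_mult_distrib[symmetric]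
    using kd step_pos by (intro sum_mono power_mono) auto
  then have "k * (k * (\<Sum>m<N. (norm (?d m))\<^sup>2)) \<le> C\<^sup>2 * Q"
    by (simp add: power2_eq_square)
  then have "k * (\<Sum>m<N. (norm (?d m))\<^sup>2) \<le> C\<^sup>2 * Q / k"
    using step_pos by (simp add: pos_le_divide_eq mult.commute)
  moreover have "Q \<le> E * sqrt (k * (\<Sum>m<N. (norm (?d m))\<^sup>2))"
    using difference_estimate[of ?d] d by (simp add: iota_d Q_def power2_norm_eq_inner)
  ultimately have "Q \<le> E * sqrt (C\<^sup>2 * Q / k)"
    using E_nonneg by (meson mult_left_mono order_trans real_sqrt_le_mono)
  \<comment> \<open>After squaring, the right side is linear in \<open>Q\<close>, so one factor
    \<open>Q\<close> cancels.\<close>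
  then have "Q\<^sup>2 \<le> (E * sqrt (C\<^sup>2 * Q / k))\<^sup>2"
    using Q by (intro power_mono)
  also have "\<dots> = E\<^sup>2 * (C\<^sup>2 * Q / k)"
    using Q step_pos by (simp add: power_mult_distrib)
  finally have "(k * Q) * Q \<le> (C\<^sup>2 * E\<^sup>2) * Q"
    using step_pos by (simp add: field_simps power2_eq_square)
  then show ?thesis
    using Q by (cases "Q = 0") (auto simp: Q_def[symmetric])
qed

text \<open>The start \<open>i = Suc m\<close> runs over the nodes 1 to N, each being the right end
  of a cell. Averaging over them produces the factor \<open>1 / T\<close>, and the embedding bounds
  the midpoints in H by their U-norms.\<close>

lemma final_value_estimate:
  assumes "k * mu \<iota> Us \<le> C" "C > 0"
  shows "(norm (h N))\<^sup>2 \<le> (2 * C\<^sub>H\<^sup>2 + C\<^sup>2 * M\<^sup>2) / T * W + (C\<^sup>2 / T + 1 / \<alpha>) * S\<^sup>2"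
proof -
  have node: "(norm (h N))\<^sup>2 \<le> 2 * C\<^sub>H\<^sup>2 * (norm (mid m))\<^sup>2 + (norm (h (Suc m) - h m))\<^sup>2 / 2 + S\<^sup>2 / \<alpha>"
    if "m < N" for m
  proof -
    have "0 \<le> \<alpha> * (k * (\<Sum>i=Suc m..<N. (norm (mid i))\<^sup>2))"
      using alpha_pos step_pos by (simp add: sum_nonneg)
    then have "(norm (h N))\<^sup>2 \<le> (norm (h (Suc m)))\<^sup>2 + S\<^sup>2 / \<alpha>"
      using energy_estimate[of "Suc m" N] that by linarith
    moreover have "(norm (h (Suc m)))\<^sup>2 \<le> 2 * C\<^sub>H\<^sup>2 * (norm (mid m))\<^sup>2 + (norm (h (Suc m) - h m))\<^sup>2 / 2"
    proof -
      \<comment> \<open>The right node is the midpoint plus half the increment.\<close>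
      have "\<iota> (mid m) + (1/2) *\<^sub>R (h (Suc m) - h m) = (1/2 + 1/2) *\<^sub>R h (Suc m)"
        unfolding scaleR_left_distrib by (simp add: mid_def h_def scale add algebra_simps)
      then have "norm (h (Suc m)) \<le> norm (\<iota> (mid m)) + norm ((1/2) *\<^sub>R (h (Suc m) - h m))"
        by (metis field_sum_of_halves norm_triangle_ineq scaleR_one)
      also have "\<dots> \<le> C\<^sub>H * norm (mid m) + norm (h (Suc m) - h m) / 2"
        using iota_le[of "mid m"] by simp
      finally have "(norm (h (Suc m)))\<^sup>2 \<le> (C\<^sub>H * norm (mid m) + norm (h (Suc m) - h m) / 2)\<^sup>2"
        by (intro power_mono) auto
      also have "\<dots> \<le> 2 * (C\<^sub>H * norm (mid m))\<^sup>2 + 2 * (norm (h (Suc m) - h m) / 2)\<^sup>2"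
        using sum_squares_bound[of "C\<^sub>H * norm (mid m)" "norm (h (Suc m) - h m) / 2"]
        by (simp only: power2_sum)
      finally show ?thesis by (simp add: power_mult_distrib power_divide)
    qed
    ultimately show ?thesis by linarith
  qed
  have "T * (norm (h N))\<^sup>2 = k * (\<Sum>m<N. (norm (h N))\<^sup>2)"
    by (subst N_times_step[symmetric]) simp
  also have "\<dots> \<le> k * (\<Sum>m<N. 2 * C\<^sub>H\<^sup>2 * (norm (mid m))\<^sup>2 + (norm (h (Suc m) - h m))\<^sup>2 / 2 + S\<^sup>2 / \<alpha>)"
    using step_pos node by (intro mult_left_mono sum_mono) auto
  also have "\<dots> = 2 * C\<^sub>H\<^sup>2 * W + (k * (\<Sum>m<N. (norm (h (Suc m) - h m))\<^sup>2)) / 2 + (real N * k) * (S\<^sup>2 / \<alpha>)"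
    by (simp add: W_def sum.distrib distrib_left flip: sum_distrib_left sum_divide_distrib)
  also have "\<dots> \<le> 2 * C\<^sub>H\<^sup>2 * W + (C\<^sup>2 * (2 * S\<^sup>2 + 2 * M\<^sup>2 * W)) / 2 + T * (S\<^sup>2 / \<alpha>)"
    using increment_estimate[OF assms] mult_left_mono[OF E_square_le, of "C\<^sup>2"] N_times_step
    by (intro add_mono divide_right_mono) auto
  also have "\<dots> = T * ((2 * C\<^sub>H\<^sup>2 + C\<^sup>2 * M\<^sup>2) / T * W + (C\<^sup>2 / T + 1 / \<alpha>) * S\<^sup>2)"
    using T_pos alpha_pos by (simp add: field_simps)
  finally show ?thesis
    using T_pos by simp
qed

text \<open>With \<open>p = norm (h N)\<close>, \<open>W\<close> is bounded linearly in
  \<open>p\<close>, while \<open>p\<^sup>2\<close> is bounded by \<open>W\<close>. Together they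
  give \<open>p\<^sup>2 \<le> 2 * b * p * S + D * S\<^sup>2\<close>, and Young's inequality absorbs
  \<open>p\<^sup>2 / 2\<close>, which explains \<open>P\<close>.\<close>

lemma Z_norm_le_inverse_estimate:
  assumes "k * mu \<iota> Us \<le> C" "C > 0"
    and "b = (2 * C\<^sub>H\<^sup>2 + C\<^sup>2 * M\<^sup>2) / T / \<alpha>" "D = b * (1 + 1 / \<alpha>) + (C\<^sup>2 / T + 1 / \<alpha>)"
    and "P = 4 * b\<^sup>2 + 2 * D"
  shows "Z_norm \<iota> T (z, w) \<le> sqrt (4 + 2 * P + 1 / \<alpha> + (2 * M\<^sup>2 + 1) * ((P + 2 + 1 / \<alpha>) / \<alpha>)) * S"
proof -
  let ?p = "norm (h N)"
  have "norm \<Phi> * ?p \<le> ?p"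
    using Phi by (simp add: mult_left_le_one_le)
  then have "(norm (h 0))\<^sup>2 \<le> (?p + S)\<^sup>2"
    using periodicity_estimate by (intro power_mono) auto
  \<comment> \<open>The squares of the final value on both sides cancel; only the mixed term
    \<open>2 * ?p * S\<close> remains.\<close>
  then have W: "\<alpha> * W \<le> 2 * ?p * S + (1 + 1 / \<alpha>) * S\<^sup>2"
    using energy_total by (simp add: power2_sum algebra_simps)
  have b: "b \<ge> 0" using T_pos alpha_pos assms(3) by simp
  have "?p\<^sup>2 \<le> b * (\<alpha> * W) + (C\<^sup>2 / T + 1 / \<alpha>) * S\<^sup>2"
    using final_value_estimate[OF assms(1,2)] alpha_pos by (simp add: assms(3))
  also have "\<dots> \<le> b * (2 * ?p * S + (1 + 1 / \<alpha>) * S\<^sup>2) + (C\<^sup>2 / T + 1 / \<alpha>) * S\<^sup>2"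
    using mult_left_mono[OF W b] by simp
  also have "\<dots> = 2 * (?p * (b * S)) + D * S\<^sup>2"
    by (simp add: assms(4) algebra_simps)
  also have "2 * (?p * (b * S)) \<le> ?p\<^sup>2 / 2 + 2 * (b * S)\<^sup>2"
    using sum_squares_bound[of "?p" "2 * (b * S)"] by (simp add: power2_eq_square)
  finally have p: "?p\<^sup>2 \<le> P * S\<^sup>2"
    by (simp add: assms(5) power_mult_distrib algebra_simps)
  have "2 * ?p * S \<le> ?p\<^sup>2 + S\<^sup>2"
    by (rule sum_squares_bound)
  then have "\<alpha> * W \<le> (P + 2 + 1 / \<alpha>) * S\<^sup>2"
    using W p by (simp add: algebra_simps)
  then have "W \<le> (P + 2 + 1 / \<alpha>) / \<alpha> * S\<^sup>2"
    using alpha_pos by (simp add: pos_le_divide_eq mult.commute)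
  from Z_norm_le[OF p this] show ?thesis .
qed

end

section \<open>From single elements to the inf-sup bound\<close>

lemma inf_sup_boundI:
  fixes \<iota> :: "'u::{real_inner,complete_space} \<Rightarrow> 'h::{real_inner,complete_space}"
  assumes "T > 0" "\<alpha> > 0" "M \<ge> 1" "dense_embedding \<iota> C\<^sub>H" "admissible_form T M \<alpha> a"
    "admissible_subspace Us" "N \<ge> 1" "norm \<Phi> \<le> 1" "K > 0"
    and *: "\<And>z w c. crank_nicolson_element T N \<iota> C\<^sub>H M \<alpha> a \<Phi> Us z w c \<Longrightarrow>
      Z_norm \<iota> T (z, w) \<le> sqrt K * crank_nicolson_element.S T N \<iota> a \<Phi> Us z w"
  shows "inf_sup_bound (1/2) \<iota> T a \<Phi> Us N (1 / sqrt K)"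
  unfolding inf_sup_bound_def
proof
  fix x assume x: "x \<in> X_space (1/2) \<iota> T Us N"
  obtain z w where zw: "x = (z, w)" by (cases x)
  with x have "w \<in> W_space (1/2) \<iota> T Us N" by (simp add: X_space_def)
  then obtain c where c: "\<And>m. m \<le> N \<Longrightarrow> c m \<in> Us" "\<And>m. m \<le> N \<Longrightarrow> w (node T N m) = \<iota> (c m)"
    "\<And>m t. m < N \<Longrightarrow> t \<in> cell T N m \<Longrightarrow> w t = \<iota> ((1/2) *\<^sub>R c (Suc m) + (1 - 1/2) *\<^sub>R c m)"
    unfolding W_space_def cell_def by blast
  interpret crank_nicolson_element T N \<iota> C\<^sub>H M \<alpha> a \<Phi> Us z w c
    using assms(1-8) x c by unfold_locales (auto simp: zw scaleR_add_right)
  have "Z_norm \<iota> T (z, w) \<le> sqrt K * S"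
    by (rule *) unfold_locales
  then show "1 / sqrt K * Z_norm \<iota> T x \<le>
      (SUP y\<in>{y \<in> Y_space \<iota> T Us N. Y_norm T y = 1}. b_form \<iota> T a \<Phi> x y)"
    using \<open>K > 0\<close> by (simp add: zw S_def pos_divide_le_eq mult.commute)
qed

theorem lemma4p4:
  fixes T \<alpha> M :: real
  assumes "T > 0" and "\<alpha> > 0" and "M \<ge> 1"
  shows
    "(\<forall>\<phi><1. \<exists>\<beta>>0.
        \<forall>(\<iota> :: 'u::{real_inner,complete_space} \<Rightarrow> 'h::{real_inner,complete_space})
         C\<^sub>H a (\<Phi> :: 'h \<Rightarrow>\<^sub>L 'h) U\<^sub>n N.
          dense_embedding \<iota> C\<^sub>H \<and> admissible_form T M \<alpha> a \<and> norm \<Phi> = \<phi> \<and>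
          admissible_subspace U\<^sub>n \<and> N \<ge> 1 \<longrightarrow>
            inf_sup_bound (1/2) \<iota> T a \<Phi> U\<^sub>n N \<beta>)
     \<and>
     (\<forall>C>0. \<forall>C\<^sub>H. \<exists>\<beta>>0.
        \<forall>(\<iota> :: 'u \<Rightarrow> 'h) a (\<Phi> :: 'h \<Rightarrow>\<^sub>L 'h) U\<^sub>n N.
          dense_embedding \<iota> C\<^sub>H \<and> admissible_form T M \<alpha> a \<and> norm \<Phi> = 1 \<and>
          admissible_subspace U\<^sub>n \<and> N \<ge> 1 \<and> step T N * mu \<iota> U\<^sub>n \<le> C \<longrightarrow>
            inf_sup_bound (1/2) \<iota> T a \<Phi> U\<^sub>n N \<beta>)"
proof (intro conjI allI impI)
  fix \<phi> :: real assume \<phi>: "\<phi> < 1"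
  \<comment> \<open>The radicand of \<open>Z_norm_le_contraction\<close>; it involves only \<alpha>,
    \<open>M\<close> and \<open>\<phi>\<close>.\<close>
  define K where "K = 4 + 2 * ((1 / (1 - \<phi>) + 1 / \<alpha>) / (1 - \<phi>)) + 1 / \<alpha> +
    (2 * M\<^sup>2 + 1) * ((1 / (1 - \<phi>) + 1 / \<alpha>) / \<alpha>)"
  have K: "K > 0"
    unfolding K_def using \<phi> \<open>\<alpha> > 0\<close> by (intro add_pos_nonneg) auto
  have "inf_sup_bound (1/2) \<iota> T a \<Phi> U\<^sub>n N (1 / sqrt K)"
    if "dense_embedding \<iota> C\<^sub>H \<and> admissible_form T M \<alpha> a \<and> norm \<Phi> = \<phi> \<and> admissible_subspace U\<^sub>n \<and> N \<ge> 1"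
    for \<iota> :: "'u \<Rightarrow> 'h" and C\<^sub>H a \<Phi> U\<^sub>n N
  proof (rule inf_sup_boundI[where C\<^sub>H = C\<^sub>H])
    fix z w c assume "crank_nicolson_element T N \<iota> C\<^sub>H M \<alpha> a \<Phi> U\<^sub>n z w c"
    then interpret crank_nicolson_element T N \<iota> C\<^sub>H M \<alpha> a \<Phi> U\<^sub>n z w c .
    show "Z_norm \<iota> T (z, w) \<le> sqrt K * S"
      using Z_norm_le_contraction that \<phi> by (auto simp: K_def)
  qed (use that assms \<phi> K in auto)
  with K show "\<exists>\<beta>>0. \<forall>(\<iota> :: 'u \<Rightarrow> 'h) C\<^sub>H a (\<Phi> :: 'h \<Rightarrow>\<^sub>L 'h) U\<^sub>n N.
      dense_embedding \<iota> C\<^sub>H \<and> admissible_form T M \<alpha> a \<and> norm \<Phi> = \<phi> \<and>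
      admissible_subspace U\<^sub>n \<and> N \<ge> 1 \<longrightarrow> inf_sup_bound (1/2) \<iota> T a \<Phi> U\<^sub>n N \<beta>"
    by (intro exI[of _ "1 / sqrt K"]) auto
next
  fix C C\<^sub>H :: real assume C: "C > 0"
  \<comment> \<open>The constants of \<open>Z_norm_le_inverse_estimate\<close>, all fixed before
    embedding, form, operator, subspace and grid; \<open>C\<^sub>H\<close> enters through
    \<open>b\<close>.\<close>
  define b where "b = (2 * C\<^sub>H\<^sup>2 + C\<^sup>2 * M\<^sup>2) / T / \<alpha>"
  define D where "D = b * (1 + 1 / \<alpha>) + (C\<^sup>2 / T + 1 / \<alpha>)"
  define P where "P = 4 * b\<^sup>2 + 2 * D"
  define K where "K = 4 + 2 * P + 1 / \<alpha> + (2 * M\<^sup>2 + 1) * ((P + 2 + 1 / \<alpha>) / \<alpha>)"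
  have "b \<ge> 0" using assms by (simp add: b_def)
  then have "P \<ge> 0" using assms by (simp add: P_def D_def)
  then have K: "K > 0"
    unfolding K_def using \<open>\<alpha> > 0\<close> by (intro add_pos_nonneg) auto
  have "inf_sup_bound (1/2) \<iota> T a \<Phi> U\<^sub>n N (1 / sqrt K)"
    if "dense_embedding \<iota> C\<^sub>H \<and> admissible_form T M \<alpha> a \<and> norm \<Phi> = 1 \<and> admissible_subspace U\<^sub>n \<and>
      N \<ge> 1 \<and> step T N * mu \<iota> U\<^sub>n \<le> C"
    for \<iota> :: "'u \<Rightarrow> 'h" and a \<Phi> U\<^sub>n N
  proof (rule inf_sup_boundI[where C\<^sub>H = C\<^sub>H])
    fix z w c assume "crank_nicolson_element T N \<iota> C\<^sub>H M \<alpha> a \<Phi> U\<^sub>n z w c"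
    then interpret crank_nicolson_element T N \<iota> C\<^sub>H M \<alpha> a \<Phi> U\<^sub>n z w c .
    show "Z_norm \<iota> T (z, w) \<le> sqrt K * S"
      using Z_norm_le_inverse_estimate[OF _ C b_def D_def P_def] that by (auto simp: K_def)
  qed (use that assms K in auto)
  with K show "\<exists>\<beta>>0. \<forall>(\<iota> :: 'u \<Rightarrow> 'h) a (\<Phi> :: 'h \<Rightarrow>\<^sub>L 'h) U\<^sub>n N.
      dense_embedding \<iota> C\<^sub>H \<and> admissible_form T M \<alpha> a \<and> norm \<Phi> = 1 \<and>
      admissible_subspace U\<^sub>n \<and> N \<ge> 1 \<and> step T N * mu \<iota> U\<^sub>n \<le> C \<longrightarrow>
      inf_sup_bound (1/2) \<iota> T a \<Phi> U\<^sub>n N \<beta>"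
    by (intro exI[of _ "1 / sqrt K"]) auto
qed

end
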